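(* Let $\mathbb{K}$ be an algebraically closed field of characteristic zero, let $n\ge 1$, and let $\mathfrak{n}=\mathrm{span}(e_{1,n+1},\ldots,e_{n,n+1})\subset \mathfrak{sl}_{n+1}=\mathfrak{sl}_{n+1}(\mathbb{K})$. Fix a polynomial $p\in \mathbb{K}[x_1,\ldots,x_n]$ and for $1\le i,j\le n$ define polynomials \[ p_{ij}:=x_i\frac{\partial p}{\partial x_j}+\delta_{ij}\frac{p(\mathbf 0)}{n},\qquad q_i:=-\frac{1}{x_i}\int_0^{x_i}\sum_{r=1}^n\left(\frac{\partial p_{ii}}{\partial x_r}\,p_{ri}+x_r\frac{\partial^2 p_{ii}}{\partial x_i\partial x_r}+\frac{\partial p_{ii}}{\partial x_i}\,p_{rr}\right)dx_i .\] Then the following action equips the space $M(p)=\mathbb{K}[x_1,\ldots,x_n]$ with an $\mathfrak{sl}_{n+1}$-module structure: for $f\in\mathbb{K}[x_1,\ldots,x_n]$ and $1\le i,j\le n$ with $i\neq j$, \begin{align*} e_{i,n+1}\cdot f&=x_if,\\ h_i\cdot f&=p_{ii}f+x_i\frac{\partial f}{\partial x_i},\\ e_{ij}\cdot f&=p_{ij}f+x_i\frac{\partial f}{\partial x_j},\\ e_{n+1,i}\cdot f&=q_if-\sum_{r=1}^n\left(p_{ri}\frac{\partial f}{\partial x_r}+p_{rr}\frac{\partial f}{\partial x_i}+x_r\frac{\partial^2 f}{\partial x_i\partial x_r}\right). \end{align*} Moreover, any $\mathfrak{sl}_{n+1}$-module $M$ whose restriction to $U(\mathfrak{n})$ is free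 of rank $1$ is isomorphic to $M(p)$ for a unique $p\in\mathbb{K}[x_1,\ldots,x_n]$.
   Context: $e_{ij}$ ($1\le i,j\le n+1$) denote the standard matrix units of $\mathfrak{gl}_{n+1}$, and $h_i:=e_{ii}-\frac{1}{n+1}I$ for $1\le i\le n$, where $I$ is the identity matrix. The elements $e_{ij}$ ($1\le i,j\le n+1$, $i\ne j$) together with $h_1,\ldots,h_n$ form a basis of $\mathfrak{sl}_{n+1}$. The subalgebra $\mathfrak{n}$ is abelian, so $U(\mathfrak{n})\simeq\mathbb{K}[x_1,\ldots,x_n]$ with $x_i=e_{i,n+1}$. The integral $\int_0^{x_i} g\,dx_i$ of a polynomial $g$ is its formal antiderivative in the variable $x_i$ that vanishes at $x_i=0$ (hence is divisible by $x_i$). *)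

theory Defs
  imports
    "HOL-Analysis.Determinants"
    "HOL-Library.Poly_Mapping"
    "HOL-Computational_Algebra.Polynomial"
begin

text \<open>
  Throughout, the indices \<open>1, \<dots>, n\<close> are the elements of a finite type \<open>'n\<close>, and the indices
  \<open>1, \<dots>, n + 1\<close> are the elements of \<open>'n option\<close>, with \<open>None\<close> in the role of \<open>n + 1\<close>.
\<close>


section \<open>Polynomials in the variables \<open>x\<^sub>i\<close>\<close>

text \<open>A polynomial maps exponent vectors \<open>'n \<Rightarrow>\<^sub>0 nat\<close> to coefficients.\<close>

type_synonym ('n, 'a) mpoly = "('n \<Rightarrow>\<^sub>0 nat) \<Rightarrow>\<^sub>0 'a"

definition mconst :: "'a::zero \<Rightarrow> ('n, 'a) mpoly" where
  "mconst c = Poly_Mapping.single 0 c"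

definition mvar :: "'n \<Rightarrow> ('n, 'a::zero_neq_one) mpoly" where
  "mvar i = Poly_Mapping.single (Poly_Mapping.single i 1) 1"

definition mscale :: "'a::comm_semiring_1 \<Rightarrow> ('n, 'a) mpoly \<Rightarrow> ('n, 'a) mpoly" where
  "mscale c f = mconst c * f"

definition meval :: "('n::finite, 'a::comm_semiring_1) mpoly \<Rightarrow> ('n \<Rightarrow> 'a) \<Rightarrow> 'a" where
  "meval f a = (\<Sum>m\<in>Poly_Mapping.keys f.
     Poly_Mapping.lookup f m * (\<Prod>i\<in>UNIV. a i ^ Poly_Mapping.lookup m i))"

text \<open>In the partial derivative, the truncated subtraction in the exponent is harmless: if
  \<open>x\<^sub>i\<close> does not occur in the monomial, then the coefficient is \<open>0\<close>.\<close>

definition mderiv :: "'n \<Rightarrow> ('n, 'a::comm_semiring_1) mpoly \<Rightarrow> ('n, 'a) mpoly" where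
  "mderiv i f = (\<Sum>m\<in>Poly_Mapping.keys f.
     Poly_Mapping.single (m - Poly_Mapping.single i 1)
       (of_nat (Poly_Mapping.lookup m i) * Poly_Mapping.lookup f m))"

text \<open>\<open>mint i f\<close> is the integral of \<open>f\<close> from \<open>0\<close> to \<open>x\<^sub>i\<close> with respect to \<open>x\<^sub>i\<close>.\<close>

definition mint :: "'n \<Rightarrow> ('n, 'a::field) mpoly \<Rightarrow> ('n, 'a) mpoly" where
  "mint i f = (\<Sum>m\<in>Poly_Mapping.keys f.
     Poly_Mapping.single (m + Poly_Mapping.single i 1)
       (Poly_Mapping.lookup f m / of_nat (Poly_Mapping.lookup m i + 1)))"

text \<open>\<open>mdivvar i f\<close> is \<open>f / x\<^sub>i\<close>; it is meaningful only if \<open>x\<^sub>i\<close> divides \<open>f\<close>.\<close>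

definition mdivvar :: "'n \<Rightarrow> ('n, 'a::comm_semiring_1) mpoly \<Rightarrow> ('n, 'a) mpoly" where
  "mdivvar i f = (THE g. mvar i * g = f)"


section \<open>The Lie algebra \<open>sl\<^bsub>n+1\<^esub>\<close> and its modules\<close>

definition sl :: "('a::comm_ring_1 ^ 'k::finite ^ 'k) set" where
  "sl = {A. trace A = 0}"

definition lie_bracket :: "'a::comm_ring_1 ^ 'k::finite ^ 'k \<Rightarrow> 'a ^ 'k ^ 'k \<Rightarrow> 'a ^ 'k ^ 'k" where
  "lie_bracket A B = A ** B - B ** A"

definition matrix_unit :: "'k::finite \<Rightarrow> 'k \<Rightarrow> 'a::zero_neq_one ^ 'k ^ 'k" where
  "matrix_unit i j = (\<chi> k l. if k = i \<and> l = j then 1 else 0)"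

definition cartan :: "'n::finite \<Rightarrow> 'a::field ^ 'n option ^ 'n option" where
  "cartan i = matrix_unit (Some i) (Some i) - mat (1 / of_nat (CARD('n) + 1))"

text \<open>A module over the Lie algebra \<open>sl\<close> is a vector space together with a Lie algebra
  homomorphism from \<open>sl\<close> to its endomorphisms. The values of \<open>act\<close> outside \<open>sl\<close> are irrelevant.\<close>

locale sl_module = vector_space sc
  for sc :: "'a::field \<Rightarrow> 'v::ab_group_add \<Rightarrow> 'v" +
  fixes act :: "'a ^ 'k::finite ^ 'k \<Rightarrow> 'v \<Rightarrow> 'v"
  assumes act_linear: "A \<in> sl \<Longrightarrow> Vector_Spaces.linear sc sc (act A)"
    and act_add: "A \<in> sl \<Longrightarrow> B \<in> sl \<Longrightarrow> act (A + B) v = act A v + act B v"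
    and act_scale: "A \<in> sl \<Longrightarrow> act (\<chi> i j. c * A $ i $ j) v = sc c (act A v)"
    and act_bracket: "A \<in> sl \<Longrightarrow> B \<in> sl \<Longrightarrow>
      act (lie_bracket A B) v = act A (act B v) - act B (act A v)"

definition sl_module_iso ::
  "('a::field \<Rightarrow> 'v::ab_group_add \<Rightarrow> 'v) \<Rightarrow> ('a ^ 'k::finite ^ 'k \<Rightarrow> 'v \<Rightarrow> 'v) \<Rightarrow>
   ('a \<Rightarrow> 'w::ab_group_add \<Rightarrow> 'w) \<Rightarrow> ('a ^ 'k ^ 'k \<Rightarrow> 'w \<Rightarrow> 'w) \<Rightarrow> bool" where
  "sl_module_iso sc act sc' act' \<longleftrightarrow>
     (\<exists>\<phi>. Vector_Spaces.linear sc sc' \<phi> \<and> bij \<phi> \<and>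
          (\<forall>A\<in>sl. \<forall>v. \<phi> (act A v) = act' A (\<phi> v)))"


section \<open>Restriction to \<open>U(\<nn>)\<close>\<close>

text \<open>
  \<open>U(\<nn>)\<close> is identified with the polynomial algebra by \<open>x\<^sub>i = e\<^bsub>i,n+1\<^esub>\<close>. The restriction to \<open>U(\<nn>)\<close> of an
  \<open>sl\<^bsub>n+1\<^esub>\<close>-module is therefore the module \<open>uscale\<close> over the polynomial ring on the same additive
  group in which constants act as scalars and \<open>x\<^sub>i\<close> acts as \<open>e\<^bsub>i,n+1\<^esub>\<close>. It exists because the
  \<open>e\<^bsub>i,n+1\<^esub>\<close> commute, and it is unique because constants and variables generate the polynomial ring.
\<close>

definition is_restriction_Un ::
  "('a::field \<Rightarrow> 'v::ab_group_add \<Rightarrow> 'v) \<Rightarrow>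
   ('a ^ 'n::finite option ^ 'n option \<Rightarrow> 'v \<Rightarrow> 'v) \<Rightarrow> (('n, 'a) mpoly \<Rightarrow> 'v \<Rightarrow> 'v) \<Rightarrow> bool" where
  "is_restriction_Un sc act uscale \<longleftrightarrow>
     module uscale \<and>
     (\<forall>c v. uscale (mconst c) v = sc c v) \<and>
     (\<forall>i v. uscale (mvar i) v = act (matrix_unit (Some i) None) v)"

definition free_of_rank :: "('r::comm_ring_1 \<Rightarrow> 'v::ab_group_add \<Rightarrow> 'v) \<Rightarrow> nat \<Rightarrow> bool" where
  "free_of_rank rscale k \<longleftrightarrow>
     (\<exists>B. finite B \<and> card B = k \<and> \<not> module.dependent rscale B \<and> module.span rscale B = UNIV)"

definition Un_free_of_rank ::
  "('a::field \<Rightarrow> 'v::ab_group_add \<Rightarrow> 'v) \<Rightarrow>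
   ('a ^ 'n::finite option ^ 'n option \<Rightarrow> 'v \<Rightarrow> 'v) \<Rightarrow> nat \<Rightarrow> bool" where
  "Un_free_of_rank sc act k \<longleftrightarrow>
     (\<exists>uscale. is_restriction_Un sc act uscale \<and> free_of_rank uscale k)"


section \<open>The action on \<open>M(p)\<close>\<close>

definition pcoef :: "('n::finite, 'a::field) mpoly \<Rightarrow> 'n \<Rightarrow> 'n \<Rightarrow> ('n, 'a) mpoly" where
  "pcoef p i j = mvar i * mderiv j p +
     (if i = j then mconst (meval p (\<lambda>_. 0) / of_nat CARD('n)) else 0)"

definition qcoef :: "('n::finite, 'a::field) mpoly \<Rightarrow> 'n \<Rightarrow> ('n, 'a) mpoly" where
  "qcoef p i = - mdivvar i (mint i (\<Sum>r\<in>UNIV.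
     mderiv r (pcoef p i i) * pcoef p r i
     + mvar r * mderiv i (mderiv r (pcoef p i i))
     + mderiv i (pcoef p i i) * pcoef p r r))"

text \<open>
  The action is given on the basis \<open>e\<^bsub>ij\<^esub>\<close> (\<open>i \<noteq> j\<close>), \<open>h\<^sub>i\<close> of \<open>sl\<^bsub>n+1\<^esub>\<close> and extended linearly. A
  traceless matrix \<open>A\<close> has coordinate \<open>A\<^bsub>ij\<^esub>\<close> at \<open>e\<^bsub>ij\<^esub>\<close> and coordinate \<open>A\<^bsub>ii\<^esub> - A\<^bsub>n+1,n+1\<^esub>\<close> at \<open>h\<^sub>i\<close>.
\<close>

definition M_act :: "('n::finite, 'a::field) mpoly \<Rightarrow> 'a ^ 'n option ^ 'n option \<Rightarrow>
    ('n, 'a) mpoly \<Rightarrow> ('n, 'a) mpoly" where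
  "M_act p A f =
     (\<Sum>i\<in>UNIV. mscale (A $ Some i $ None) (mvar i * f))
     + (\<Sum>i\<in>UNIV. mscale (A $ Some i $ Some i - A $ None $ None)
          (pcoef p i i * f + mvar i * mderiv i f))
     + (\<Sum>i\<in>UNIV. \<Sum>j\<in>UNIV - {i}. mscale (A $ Some i $ Some j)
          (pcoef p i j * f + mvar i * mderiv j f))
     + (\<Sum>i\<in>UNIV. mscale (A $ None $ Some i)
          (qcoef p i * f - (\<Sum>r\<in>UNIV. pcoef p r i * mderiv r f + pcoef p r r * mderiv i f
             + mvar r * mderiv i (mderiv r f))))"

end

theory Submission
  imports Defs
begin

text \<open>
  Write \<open>\<nabla>\<^sub>i = \<partial>\<^sub>i + \<partial>\<^sub>i p\<close>, \<open>c = p(0) / n\<close> and \<open>F = \<Sum>\<^sub>r x\<^sub>r \<nabla>\<^sub>r + (n + 1) c\<close>. The operators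
  \<open>x\<^sub>i\<close> and \<open>\<nabla>\<^sub>i\<close> satisfy the relations of the Weyl algebra, and \<open>q\<^sub>i = - F (\<partial>\<^sub>i p)\<close>, so that
  \<open>e\<^bsub>i,n+1\<^esub>\<close>, \<open>e\<^bsub>ij\<^esub>\<close>, \<open>h\<^sub>i\<close>, \<open>e\<^bsub>n+1,i\<^esub>\<close> act by \<open>x\<^sub>i\<close>, \<open>x\<^sub>i \<nabla>\<^sub>j\<close>, \<open>x\<^sub>i \<nabla>\<^sub>i + c\<close>, \<open>- F \<nabla>\<^sub>i\<close>.
  Thus the module axioms follow from the Weyl relations.

  Conversely, a module that is free of rank 1 can be moved to the polynomial ring with \<open>e\<^bsub>i,n+1\<^esub>\<close>
  acting by \<open>x\<^sub>i\<close>. The brackets with \<open>e\<^bsub>k,n+1\<^esub>\<close> force \<open>e\<^bsub>ij\<^esub>\<close> and \<open>h\<^sub>i\<close> to act by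
  \<open>P\<^bsub>ij\<^esub> + x\<^sub>i \<partial>\<^sub>j\<close>, where \<open>P\<close> is a cocycle of \<open>gl\<^sub>n\<close>; solving the Euler equation
  \<open>\<Sum>\<^sub>r x\<^sub>r \<partial>\<^sub>r p = T - T(0)\<close> for \<open>T = \<Sum>\<^sub>r P\<^bsub>rr\<^esub>\<close> with \<open>p(0) = T(0)\<close> yields the polynomial.
  The action of \<open>e\<^bsub>n+1,i\<^esub>\<close> is then determined up to multiplication by some \<open>w\<close>, and the bracket with
  \<open>h\<^sub>i\<close> gives \<open>(x\<^sub>i \<partial>\<^sub>i + 1) w = 0\<close>, so \<open>w = 0\<close>. Finally, an isomorphism from \<open>M(p)\<close> to \<open>M(p')\<close> is
  multiplication by a unit, hence by a constant, and so \<open>p = p'\<close>.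
\<close>


section \<open>Polynomials\<close>

lemma mvar_mult_single:
  "mvar i * Poly_Mapping.single m c =
     Poly_Mapping.single (m + Poly_Mapping.single i 1) (c :: 'a::comm_semiring_1)"
  unfolding mvar_def mult_single by (simp add: add.commute)

text \<open>Every monomial arises from a constant by multiplying with one variable at a time. The
  rule serves to prove the Leibniz rule and to recognise multiplication operators.\<close>

lemma mpoly_induct [case_names const var add]:
  fixes f :: "('n, 'a::comm_semiring_1) mpoly"
  assumes const: "\<And>c. P (mconst c)"
    and var: "\<And>i f. P f \<Longrightarrow> P (mvar i * f)"
    and add: "\<And>f g. P f \<Longrightarrow> P g \<Longrightarrow> P (f + g)"
  shows "P f"
proof -
  have monom: "P (Poly_Mapping.single m c)" for m c
  proof (induction m rule: update_induct)
    case const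
    show ?case using assms(1)[of c] by (simp add: mconst_def)
  next
    case (update m i k)
    have "Poly_Mapping.update i k m = m + Poly_Mapping.single i k"
      using update(1)
      by (intro poly_mapping_eqI) (auto simp: lookup_update lookup_add lookup_single in_keys_iff)
    moreover have "P (Poly_Mapping.single (m + Poly_Mapping.single i k) c)"
    proof (induction k)
      case 0
      show ?case using update by simp
    next
      case (Suc k)
      have "m + Poly_Mapping.single i (Suc k) = m + Poly_Mapping.single i k + Poly_Mapping.single i 1"
        by (simp add: add.assoc flip: single_add)
      then show ?case
        using var[OF Suc, of i] by (simp only: mvar_mult_single)
    qed
    ultimately show ?case by simp
  qed
  show ?thesis
  proof (induction f rule: update_induct)
    case const
    show ?case using monom[of 0 0] by simp
  next
    case (update f m c)
    have "Poly_Mapping.update m c f = f + Poly_Mapping.single m c"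
      using update(1)
      by (intro poly_mapping_eqI) (auto simp: lookup_update lookup_add lookup_single in_keys_iff)
    then show ?case using update add monom by simp
  qed
qed

lemma mconst_simps [simp]:
  "mconst 0 = 0" "mconst 1 = 1"
  by (simp_all add: mconst_def)

lemma mconst_add: "mconst (a + b) = mconst a + mconst b"
  by (simp add: mconst_def single_add)

lemma mconst_diff: "mconst (a - b :: 'a::comm_ring_1) = mconst a - mconst b"
  by (simp add: mconst_def single_diff)

lemma mconst_mult: "mconst (a * b) = mconst a * mconst b"
  by (simp add: mconst_def mult_single)

lemma mconst_of_nat [simp]: "mconst (of_nat k) = of_nat k"
  by (simp add: mconst_def)

lemma mconst_sum: "mconst (\<Sum>i\<in>A. f i) = (\<Sum>i\<in>A. mconst (f i))"
  by (induction A rule: infinite_finite_induct) (auto simp: mconst_add)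

lemma lookup_mconst: "Poly_Mapping.lookup (mconst c) m = (if m = 0 then c else 0)"
  by (auto simp: mconst_def lookup_single)

lemma lookup_mconst_mult:
  "Poly_Mapping.lookup (mconst c * f) m = c * Poly_Mapping.lookup (f :: ('n, 'a::comm_semiring_1) mpoly) m"
  unfolding mconst_def mult_map_scale_conv_mult[symmetric]
  by (simp add: Poly_Mapping.map.rep_eq when_def)

lemma sum_single_lookup:
  "(\<Sum>m\<in>Poly_Mapping.keys f. Poly_Mapping.single m (Poly_Mapping.lookup f m)) = f"
  by (rule poly_mapping_eqI)
    (auto simp: lookup_sum lookup_single when_def in_keys_iff sum.delta)

lemma single_one_le:
  assumes "Poly_Mapping.lookup m i \<noteq> 0"
  shows "m - Poly_Mapping.single i (Suc 0) + Poly_Mapping.single i (Suc 0) = m"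
  using assms by (intro poly_mapping_eqI) (auto simp: lookup_add lookup_minus lookup_single when_def)

lemma lookup_mvar_mult:
  "Poly_Mapping.lookup (mvar i * f) m =
     (if Poly_Mapping.lookup m i = 0 then 0
      else Poly_Mapping.lookup (f :: ('n, 'a::comm_semiring_1) mpoly) (m - Poly_Mapping.single i 1))"
proof -
  have "mvar i * f = (\<Sum>k\<in>Poly_Mapping.keys f.
      Poly_Mapping.single (k + Poly_Mapping.single i 1) (Poly_Mapping.lookup f k))"
    by (subst sum_single_lookup[of f, symmetric]) (simp only: sum_distrib_left mvar_mult_single)
  then have *: "Poly_Mapping.lookup (mvar i * f) m = (\<Sum>k\<in>Poly_Mapping.keys f.
      if k + Poly_Mapping.single i 1 = m then Poly_Mapping.lookup f k else 0)"
    by (simp add: lookup_sum lookup_single when_def)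
  show ?thesis
  proof (cases "Poly_Mapping.lookup m i = 0")
    case True
    then have "k + Poly_Mapping.single i 1 \<noteq> m" for k
      by (auto simp: lookup_add)
    with True * show ?thesis by simp
  next
    case False
    then have "k + Poly_Mapping.single i 1 = m \<longleftrightarrow> k = m - Poly_Mapping.single i 1" for k
      using single_one_le[of m i] by auto
    with False * show ?thesis by (simp add: in_keys_iff)
  qed
qed

text \<open>Multiplication by x_i only shifts exponents, so no property of the coefficients is
  involved. This makes the quotient in \<open>mdivvar\<close> unique.\<close>

lemma mvar_mult_cancel: "mvar i * f = mvar i * g \<longleftrightarrow> f = (g :: ('n, 'a::comm_semiring_1) mpoly)"
proof
  assume *: "mvar i * f = mvar i * g"
  show "f = g"
  proof (rule poly_mapping_eqI)
    fix m
    show "Poly_Mapping.lookup f m = Poly_Mapping.lookup g m"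
      using arg_cong[OF *, of "\<lambda>f. Poly_Mapping.lookup f (m + Poly_Mapping.single i 1)"]
      by (simp add: lookup_mvar_mult lookup_add)
  qed
qed simp

lemma mdivvar_mvar_mult [simp]: "mdivvar i (mvar i * f) = f"
  unfolding mdivvar_def by (rule the_equality) (auto simp: mvar_mult_cancel)

text \<open>Since 0^0 = 1, exactly the constant monomial survives evaluation at the origin.\<close>

lemma meval_zero:
  fixes f :: "('n::finite, 'a::comm_semiring_1) mpoly"
  shows "meval f (\<lambda>_. 0) = Poly_Mapping.lookup f 0"
proof -
  have "(\<Prod>i\<in>UNIV. (0::'a) ^ Poly_Mapping.lookup m i) = (if m = 0 then 1 else 0)" for m :: "'n \<Rightarrow>\<^sub>0 nat"
  proof (cases "m = 0")
    case False
    then obtain i where "Poly_Mapping.lookup m i \<noteq> 0"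
      by (metis lookup_zero poly_mapping_eqI)
    with False show ?thesis by (auto simp: power_0_left intro!: prod_zero bexI[of _ i])
  qed simp
  then show ?thesis unfolding meval_def by (simp add: if_distrib[of "\<lambda>x. _ * x"] in_keys_iff cong: if_cong)
qed


section \<open>Derivatives and integrals\<close>

lemma lookup_mderiv:
  "Poly_Mapping.lookup (mderiv i f) m =
     of_nat (Poly_Mapping.lookup m i + 1) * Poly_Mapping.lookup f (m + Poly_Mapping.single i 1)"
proof -
  \<comment> \<open>Truncated subtraction may send several exponents \<open>k\<close> to
    \<open>m\<close>. All but \<open>m + Poly_Mapping.single i 1\<close> have \<open>i\<close>-th
    entry 0, so their coefficient vanishes.\<close>
  have eq: "of_nat (Poly_Mapping.lookup k i) * x =
      (if k = m + Poly_Mapping.single i 1 then of_nat (Poly_Mapping.lookup m i + 1) * x else 0)"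
    if "k - Poly_Mapping.single i 1 = m" for k and x :: 'a
  proof (cases "Poly_Mapping.lookup k i = 0")
    case True
    then have "k \<noteq> m + Poly_Mapping.single i 1" by (auto simp: lookup_add)
    with True show ?thesis by simp
  next
    case False
    then have "k = m + Poly_Mapping.single i 1" using single_one_le[of k i] that by simp
    then show ?thesis by (simp add: lookup_add)
  qed
  have "Poly_Mapping.lookup (mderiv i f) m = (\<Sum>k\<in>Poly_Mapping.keys f.
      if k - Poly_Mapping.single i 1 = m
      then of_nat (Poly_Mapping.lookup k i) * Poly_Mapping.lookup f k else 0)"
    by (simp add: mderiv_def lookup_sum lookup_single when_def)
  also have "\<dots> = (\<Sum>k\<in>Poly_Mapping.keys f. if k = m + Poly_Mapping.single i 1
      then of_nat (Poly_Mapping.lookup m i + 1) * Poly_Mapping.lookup f k else 0)"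
    by (intro sum.cong refl) (use eq in \<open>auto simp: lookup_add\<close>)
  also have "\<dots> = of_nat (Poly_Mapping.lookup m i + 1) * Poly_Mapping.lookup f (m + Poly_Mapping.single i 1)"
    by (simp add: in_keys_iff)
  finally show ?thesis .
qed

lemma mderiv_add: "mderiv i (f + g) = mderiv i f + mderiv i g"
  by (rule poly_mapping_eqI) (simp only: lookup_mderiv lookup_add distrib_left)

lemma mderiv_zero [simp]: "mderiv i 0 = 0"
  by (simp add: mderiv_def)

lemma mderiv_minus: "mderiv i (- f) = - mderiv i (f :: ('n, 'a::comm_ring_1) mpoly)"
  by (rule poly_mapping_eqI) (simp add: lookup_mderiv)

lemma mderiv_diff: "mderiv i (f - g) = mderiv i f - mderiv i (g :: ('n, 'a::comm_ring_1) mpoly)"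
  by (rule poly_mapping_eqI) (simp only: lookup_mderiv lookup_minus right_diff_distrib)

lemma mderiv_sum: "mderiv i (\<Sum>a\<in>A. f a) = (\<Sum>a\<in>A. mderiv i (f a))"
  by (induction A rule: infinite_finite_induct) (auto simp: mderiv_add)

lemma mderiv_mconst [simp]: "mderiv i (mconst c) = 0"
proof (rule poly_mapping_eqI)
  fix m :: "'a \<Rightarrow>\<^sub>0 nat"
  have "m + Poly_Mapping.single i 1 \<noteq> 0"
    by (metis add_is_0 lookup_add lookup_single_eq lookup_zero one_neq_zero)
  then show "Poly_Mapping.lookup (mderiv i (mconst c)) m = Poly_Mapping.lookup 0 m"
    by (simp add: lookup_mderiv lookup_mconst)
qed

lemma mderiv_one [simp]: "mderiv i (1 :: ('n, 'a::comm_semiring_1) mpoly) = 0"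
  using mderiv_mconst[of i "1 :: 'a"] by (simp del: mderiv_mconst)

lemma mderiv_mconst_mult: "mderiv i (mconst c * f) = mconst c * mderiv i f"
  by (rule poly_mapping_eqI) (simp add: lookup_mderiv lookup_mconst_mult mult.left_commute)

lemma mderiv_mvar_mult:
  "mderiv j (mvar i * f) = mvar i * mderiv j f + (if i = j then f else 0)"
proof (rule poly_mapping_eqI)
  fix m :: "'a \<Rightarrow>\<^sub>0 nat"
  show "Poly_Mapping.lookup (mderiv j (mvar i * f)) m =
      Poly_Mapping.lookup (mvar i * mderiv j f + (if i = j then f else 0)) m"
  proof (cases "i = j")
    case True
    then show ?thesis
      by (auto simp: lookup_mderiv lookup_mvar_mult lookup_add lookup_minus single_one_le
          distrib_right add.commute[of _ "Poly_Mapping.lookup f m"])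
  next
    case False
    have "m + Poly_Mapping.single j (Suc 0) - Poly_Mapping.single i (Suc 0) =
        m - Poly_Mapping.single i (Suc 0) + Poly_Mapping.single j (Suc 0)"
      if "Poly_Mapping.lookup m i \<noteq> 0"
      using that False
      by (intro poly_mapping_eqI) (auto simp: lookup_add lookup_minus lookup_single when_def)
    with False show ?thesis
      by (auto simp: lookup_mderiv lookup_mvar_mult lookup_add lookup_minus lookup_single)
  qed
qed

lemma mderiv_mult: "mderiv i (f * g) = mderiv i f * g + f * mderiv i g"
  by (induction f rule: mpoly_induct)
    (auto simp: mderiv_mconst_mult mult.assoc mderiv_mvar_mult mderiv_add distrib_left distrib_right
      add_ac)

lemma mderiv_commute: "mderiv i (mderiv j f) = mderiv j (mderiv i f)"
  by (rule poly_mapping_eqI)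
    (cases "i = j"; simp add: lookup_mderiv lookup_add lookup_single algebra_simps)

lemma mderiv_mvar [simp]:
  "mderiv j (mvar i) = (if i = j then 1 else 0 :: ('n, 'a::comm_semiring_1) mpoly)"
  using mderiv_mvar_mult[of j i "1 :: ('n, 'a) mpoly"] by simp

text \<open>The operator x_i d/dx_i is diagonal on monomials, so equations involving it can be
  solved coefficient by coefficient.\<close>

lemma lookup_mvar_mderiv:
  "Poly_Mapping.lookup (mvar i * mderiv i f) m = of_nat (Poly_Mapping.lookup m i) * Poly_Mapping.lookup f m"
  by (auto simp: lookup_mvar_mult lookup_mderiv single_one_le lookup_minus)

text \<open>A nonconstant monomial contains some x_i, and in characteristic 0 its coefficient can be
  read off from the derivative in that variable.\<close>

lemma mderiv_eq_imp_eq: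
  fixes f g :: "('n, 'a::field_char_0) mpoly"
  assumes deriv: "\<And>i. mderiv i f = mderiv i g"
    and zero: "Poly_Mapping.lookup f 0 = Poly_Mapping.lookup g 0"
  shows "f = g"
proof (rule poly_mapping_eqI)
  fix m
  show "Poly_Mapping.lookup f m = Poly_Mapping.lookup g m"
  proof (cases "m = 0")
    case False
    then obtain i where "Poly_Mapping.lookup m i \<noteq> 0"
      by (metis lookup_zero poly_mapping_eqI)
    then show ?thesis
      using arg_cong[OF deriv[of i], of "\<lambda>f. Poly_Mapping.lookup (mvar i * f) m"]
      by (simp add: lookup_mvar_mderiv)
  qed (use zero in simp)
qed

lemma lookup_mint:
  "Poly_Mapping.lookup (mint i f) m =
     (if Poly_Mapping.lookup m i = 0 then 0
      else Poly_Mapping.lookup f (m - Poly_Mapping.single i 1) / of_nat (Poly_Mapping.lookup m i))"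
proof -
  have *: "Poly_Mapping.lookup (mint i f) m = (\<Sum>k\<in>Poly_Mapping.keys f.
      if k + Poly_Mapping.single i 1 = m
      then Poly_Mapping.lookup f k / of_nat (Poly_Mapping.lookup k i + 1) else 0)"
    by (simp only: mint_def lookup_sum lookup_single when_def)
  show ?thesis
  proof (cases "Poly_Mapping.lookup m i = 0")
    case True
    then have "k + Poly_Mapping.single i 1 \<noteq> m" for k
      by (auto simp: lookup_add)
    with True * show ?thesis by simp
  next
    case False
    then have "k + Poly_Mapping.single i 1 = m \<longleftrightarrow> k = m - Poly_Mapping.single i 1" for k
      using single_one_le[of m i] by auto
    with False * show ?thesis by (simp add: in_keys_iff lookup_minus)
  qed
qed

text \<open>A multiple of x_i vanishes at x_i = 0, so integration recovers it from its derivative.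
  The integral defining q_i is evaluated this way.\<close>

lemma mint_mderiv_mvar_mult:
  fixes g :: "('n, 'a::field_char_0) mpoly"
  shows "mint i (mderiv i (mvar i * g)) = mvar i * g"
  by (rule poly_mapping_eqI)
    (auto simp: lookup_mint lookup_mderiv single_one_le lookup_minus lookup_mvar_mult simp del: of_nat_Suc)


section \<open>The Lie algebra action in terms of the Weyl algebra\<close>

definition euler :: "('n::finite, 'a::comm_ring_1) mpoly \<Rightarrow> ('n, 'a) mpoly" where
  "euler f = (\<Sum>r\<in>UNIV. mvar r * mderiv r f)"

lemma euler_add: "euler (f + g) = euler f + euler g"
  by (simp add: euler_def mderiv_add distrib_left sum.distrib)

lemma euler_minus: "euler (- f) = - euler f"
  by (simp add: euler_def mderiv_minus sum_negf)

lemma euler_diff: "euler (f - g) = euler f - euler g"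
  using euler_add[of f "- g"] by (simp add: euler_minus)

lemma euler_mconst [simp]: "euler (mconst c) = 0"
  by (simp add: euler_def)

lemma euler_mult: "euler (f * g) = euler f * g + f * euler g"
  by (simp add: euler_def mderiv_mult distrib_left sum.distrib sum_distrib_left sum_distrib_right
      algebra_simps)

lemma euler_mvar [simp]: "euler (mvar i) = mvar i"
  by (simp add: euler_def if_distrib[of "\<lambda>x. _ * x"] cong: if_cong)

text \<open>The Euler operator measures the degree, which a partial derivative lowers by
  one.\<close>

lemma mderiv_euler: "mderiv i (euler f) = euler (mderiv i f) + mderiv i f"
  by (simp add: euler_def mderiv_sum mderiv_mvar_mult sum.distrib mderiv_commute[of i])

lemma lookup_euler:
  "Poly_Mapping.lookup (euler f) m = of_nat (\<Sum>i\<in>UNIV. Poly_Mapping.lookup m i) * Poly_Mapping.lookup f m"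
  by (simp add: euler_def lookup_sum lookup_mvar_mderiv sum_distrib_right)

section \<open>Weyl algebra relations for the twisted derivatives and the operator F\<close>

definition nabla :: "('n, 'a::comm_ring_1) mpoly \<Rightarrow> 'n \<Rightarrow> ('n, 'a) mpoly \<Rightarrow> ('n, 'a) mpoly" where
  "nabla p i f = mderiv i f + mderiv i p * f"

definition pconst :: "('n::finite, 'a::field) mpoly \<Rightarrow> 'a" where
  "pconst p = Poly_Mapping.lookup p 0 / of_nat CARD('n)"

text \<open>This is F from the overview, expanded by means of the identity that the sum of x_r
  \<open>nabla p r f\<close> equals \<open>euler f + euler p * f\<close>.\<close>

definition shifted_euler :: "('n::finite, 'a::field) mpoly \<Rightarrow> ('n, 'a) mpoly \<Rightarrow> ('n, 'a) mpoly" where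
  "shifted_euler p f = euler f + (euler p + mconst (of_nat (CARD('n) + 1) * pconst p)) * f"

lemma nabla_add: "nabla p i (f + g) = nabla p i f + nabla p i g"
  by (simp add: nabla_def mderiv_add distrib_left)

lemma nabla_minus: "nabla p i (- f) = - nabla p i f"
  by (simp add: nabla_def mderiv_minus)

lemma nabla_mconst_mult: "nabla p i (mconst c * f) = mconst c * nabla p i f"
  by (simp add: nabla_def mderiv_mult algebra_simps)

text \<open>The added multiplication by a derivative of \<open>p\<close> commutes with x_i, so the
  Weyl relation of the plain derivative persists.\<close>

lemma nabla_mvar_mult: "nabla p j (mvar i * f) = mvar i * nabla p j f + (if i = j then f else 0)"
  by (simp add: nabla_def mderiv_mult algebra_simps)

lemma nabla_commute: "nabla p i (nabla p j f) = nabla p j (nabla p i f)"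
  by (simp add: nabla_def mderiv_add mderiv_mult mderiv_commute[of i] algebra_simps)

lemma shifted_euler_add: "shifted_euler p (f + g) = shifted_euler p f + shifted_euler p g"
  by (simp add: shifted_euler_def euler_add algebra_simps)

lemma shifted_euler_minus: "shifted_euler p (- f) = - shifted_euler p f"
  by (simp add: shifted_euler_def euler_minus)

lemma shifted_euler_diff: "shifted_euler p (f - g) = shifted_euler p f - shifted_euler p g"
  using shifted_euler_add[of p f "- g"] by (simp add: shifted_euler_minus)

lemma shifted_euler_zero [simp]: "shifted_euler p 0 = 0"
  using shifted_euler_diff[of p 0 0] by simp

lemma shifted_euler_mconst_mult: "shifted_euler p (mconst c * f) = mconst c * shifted_euler p f"
  by (simp add: shifted_euler_def euler_mult algebra_simps)

lemma shifted_euler_mvar_mult: "shifted_euler p (mvar i * f) = mvar i * shifted_euler p f + mvar i * f"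
  by (simp add: shifted_euler_def euler_mult algebra_simps)

lemma nabla_shifted_euler: "nabla p j (shifted_euler p f) = shifted_euler p (nabla p j f) + nabla p j f"
  by (simp add: shifted_euler_def nabla_def mderiv_add mderiv_mult mderiv_euler euler_add euler_mult
      algebra_simps)

text \<open>With \<open>\<nabla>\<^sub>i = \<partial>\<^sub>i + \<partial>\<^sub>i p\<close>, the conjugate of \<open>\<partial>\<^sub>i\<close> by \<open>exp p\<close>, this is
  a representation of \<open>gl\<^bsub>n+1\<^esub>\<close>, whose restriction to \<open>sl\<^bsub>n+1\<^esub>\<close> is \<open>M(p)\<close>.\<close>

fun unit_act :: "('n::finite, 'a::field) mpoly \<Rightarrow> 'n option \<Rightarrow> 'n option \<Rightarrow> ('n, 'a) mpoly \<Rightarrow> ('n, 'a) mpoly" where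
  "unit_act p (Some i) (Some j) f = mvar i * nabla p j f"
| "unit_act p (Some i) None f = mvar i * f"
| "unit_act p None (Some j) f = - shifted_euler p (nabla p j f)"
| "unit_act p None None f = - shifted_euler p f"

lemma unit_act_add: "unit_act p a b (f + g) = unit_act p a b f + unit_act p a b g"
  by (cases a; cases b) (simp_all add: nabla_add shifted_euler_add distrib_left)

lemma unit_act_mconst_mult: "unit_act p a b (mconst c * f) = mconst c * unit_act p a b f"
  by (cases a; cases b) (simp_all add: nabla_mconst_mult shifted_euler_mconst_mult mult.left_commute)

lemma unit_act_zero [simp]: "unit_act p a b 0 = 0"
  using unit_act_mconst_mult[of p a b 0 0] by simp

lemma unit_act_sum: "unit_act p a b (\<Sum>k\<in>K. f k) = (\<Sum>k\<in>K. unit_act p a b (f k))"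
  by (induction K rule: infinite_finite_induct) (auto simp: unit_act_add)

text \<open>Every case follows from the Weyl relations together with F x_i = x_i (F + 1) and nabla_j
  F = (F + 1) nabla_j.\<close>

lemma unit_act_bracket:
  "unit_act p a b (unit_act p c d f) - unit_act p c d (unit_act p a b f) =
     (if b = c then unit_act p a d f else 0) - (if a = d then unit_act p c b f else 0)"
  by (cases a; cases b; cases c; cases d)
    (auto simp: nabla_add nabla_minus nabla_mvar_mult shifted_euler_add shifted_euler_minus
      shifted_euler_diff shifted_euler_mvar_mult nabla_shifted_euler nabla_commute distrib_left
      right_diff_distrib mult.left_commute)

section \<open>The formulas for p_ij and q_i in terms of the twisted operators\<close>

lemma sum_UNIV_option: "(\<Sum>a\<in>UNIV. g a) = g None + (\<Sum>i\<in>UNIV. g (Some (i :: 'n::finite)))"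
  by (simp add: UNIV_option_conv sum.reindex)

lemma pcoef_eq: "pcoef p i j = mvar i * mderiv j p + (if i = j then mconst (pconst p) else 0)"
  by (simp add: pcoef_def meval_zero pconst_def)

text \<open>The same sum occurs twice: with \<open>f\<close> = p_ii as the integrand of q_i, and
  with arbitrary \<open>f\<close> in the action of e_{n+1,i}.\<close>

lemma sum_pcoef_mderiv:
  fixes p f :: "('n::finite, 'a::field) mpoly"
  shows "(\<Sum>r\<in>UNIV. mderiv r f * pcoef p r i + mvar r * mderiv i (mderiv r f) + mderiv i f * pcoef p r r) =
    mderiv i p * euler f + (euler p + mconst (of_nat (CARD('n) + 1) * pconst p)) * mderiv i f
    + euler (mderiv i f)"
proof -
  have "(\<Sum>r\<in>UNIV. mderiv r f * pcoef p r i) = mderiv i p * euler f + mconst (pconst p) * mderiv i f"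
    by (simp add: pcoef_eq euler_def algebra_simps sum.distrib sum_distrib_left
        if_distrib[of "\<lambda>x. _ * x"] cong: if_cong)
  moreover have "(\<Sum>r\<in>UNIV. mvar r * mderiv i (mderiv r f)) = euler (mderiv i f)"
    by (simp add: euler_def mderiv_commute[of i])
  moreover have "(\<Sum>r\<in>UNIV. mderiv i f * pcoef p r r) = (euler p + of_nat CARD('n) * mconst (pconst p)) * mderiv i f"
    by (simp add: pcoef_eq euler_def algebra_simps sum.distrib sum_distrib_left)
  ultimately show ?thesis
    by (simp add: sum.distrib mconst_mult mconst_add algebra_simps)
qed

text \<open>The integrand of q_i is the x_i-derivative of x_i F(dp/dx_i), so both the integration
  and the division by x_i can be carried out exactly.\<close>

lemma qcoef_eq:
  fixes p :: "('n::finite, 'a::field_char_0) mpoly"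
  shows "qcoef p i = - shifted_euler p (mderiv i p)"
proof -
  have "(\<Sum>r\<in>UNIV. mderiv r (pcoef p i i) * pcoef p r i + mvar r * mderiv i (mderiv r (pcoef p i i))
      + mderiv i (pcoef p i i) * pcoef p r r) = mderiv i (mvar i * shifted_euler p (mderiv i p))"
    unfolding sum_pcoef_mderiv
    by (simp add: pcoef_eq shifted_euler_def mderiv_add euler_add mderiv_mult euler_mult mderiv_euler
        algebra_simps)
  then show ?thesis
    by (simp add: qcoef_def mint_mderiv_mvar_mult)
qed

lemma pcoef_act:
  "pcoef p i j * f + mvar i * mderiv j f =
     mvar i * nabla p j f + (if i = j then mconst (pconst p) * f else 0)"
  by (simp add: pcoef_eq nabla_def algebra_simps)

text \<open>By the Leibniz rule, F applied to (dp/dx_i) f is F(dp/dx_i) f + (dp/dx_i)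
  \<open>euler f\<close>. The first term accounts for q_i f, the rest for the sum.\<close>

lemma qcoef_act:
  fixes p f :: "('n::finite, 'a::field_char_0) mpoly"
  shows "qcoef p i * f - (\<Sum>r\<in>UNIV. pcoef p r i * mderiv r f + pcoef p r r * mderiv i f
    + mvar r * mderiv i (mderiv r f)) = - shifted_euler p (nabla p i f)"
proof -
  have "(\<Sum>r\<in>UNIV. pcoef p r i * mderiv r f + pcoef p r r * mderiv i f + mvar r * mderiv i (mderiv r f)) =
      (\<Sum>r\<in>UNIV. mderiv r f * pcoef p r i + mvar r * mderiv i (mderiv r f) + mderiv i f * pcoef p r r)"
    by (intro sum.cong refl) (simp add: algebra_simps)
  then show ?thesis
    unfolding sum_pcoef_mderiv
    by (simp add: qcoef_eq shifted_euler_def nabla_def euler_add euler_mult algebra_simps)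
qed

text \<open>On traceless matrices the coordinates in the basis e_ij, h_i can be traded for matrix
  entries, which makes the action the restriction of a representation of gl_{n+1}.\<close>

lemma M_act_eq:
  fixes p f :: "('n::finite, 'a::field_char_0) mpoly"
  assumes "A \<in> sl"
  shows "M_act p A f = (\<Sum>a\<in>UNIV. \<Sum>b\<in>UNIV. mconst (A $ a $ b) * unit_act p a b f)"
proof -
  have "A $ None $ None + (\<Sum>i\<in>UNIV. A $ Some i $ Some i) = 0"
    using assms by (simp add: sl_def trace_def sum_UNIV_option)
  then have tr: "(\<Sum>i\<in>UNIV. A $ Some i $ Some i) = - A $ None $ None"
    by (simp add: eq_neg_iff_add_eq_0 add.commute)
  let ?s = "mconst (pconst p)"
  \<comment> \<open>The constant \<open>pconst p\<close> occurs with coefficient -A_{n+1,n+1} from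
    the trace condition and -n A_{n+1,n+1} from the subtracted entries. Together they supply the
    shift (n + 1) \<open>pconst p\<close> in F.\<close>
  have diag: "(\<Sum>i\<in>UNIV. mscale (A $ Some i $ Some i - A $ None $ None) (pcoef p i i * f + mvar i * mderiv i f)) =
      (\<Sum>i\<in>UNIV. mconst (A $ Some i $ Some i) * (mvar i * nabla p i f))
      - mconst (A $ None $ None) * shifted_euler p f"
  proof -
    have e1: "(\<Sum>i\<in>UNIV. mscale (A $ Some i $ Some i - A $ None $ None) (pcoef p i i * f + mvar i * mderiv i f)) =
      (\<Sum>i\<in>UNIV. mconst (A $ Some i $ Some i) * (mvar i * nabla p i f))
      + mconst (\<Sum>i\<in>UNIV. A $ Some i $ Some i) * ?s * f
      - mconst (A $ None $ None) * (\<Sum>i\<in>UNIV. mvar i * nabla p i f)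
      - of_nat CARD('n) * mconst (A $ None $ None) * ?s * f"
      unfolding mscale_def pcoef_act
      by (simp add: mconst_diff mconst_sum sum.distrib sum_subtractf
          sum_distrib_left sum_distrib_right algebra_simps)
    have e2: "(\<Sum>i\<in>UNIV. mvar i * nabla p i f) = euler f + euler p * f"
      by (simp add: nabla_def euler_def distrib_left sum.distrib sum_distrib_right mult.assoc)
    have e3: "mconst (\<Sum>i\<in>UNIV. A $ Some i $ Some i) = - mconst (A $ None $ None)"
      by (simp add: tr mconst_def single_uminus)
    show ?thesis
      unfolding e1 e2 e3 by (simp add: shifted_euler_def mconst_mult mconst_add algebra_simps)
  qed
  have offdiag: "(\<Sum>i\<in>UNIV. mconst (A $ Some i $ Some i) * (mvar i * nabla p i f))
      + (\<Sum>i\<in>UNIV. \<Sum>j\<in>UNIV - {i}. mscale (A $ Some i $ Some j) (pcoef p i j * f + mvar i * mderiv j f)) =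
      (\<Sum>i\<in>UNIV. \<Sum>j\<in>UNIV. mconst (A $ Some i $ Some j) * (mvar i * nabla p j f))"
  proof -
    have "(\<Sum>j\<in>UNIV - {i}. mscale (A $ Some i $ Some j) (pcoef p i j * f + mvar i * mderiv j f)) =
      (\<Sum>j\<in>UNIV - {i}. mconst (A $ Some i $ Some j) * (mvar i * nabla p j f))" for i
      by (intro sum.cong refl) (auto simp: mscale_def pcoef_act)
    moreover have "mconst (A $ Some i $ Some i) * (mvar i * nabla p i f) +
        (\<Sum>j\<in>UNIV - {i}. mconst (A $ Some i $ Some j) * (mvar i * nabla p j f)) =
        (\<Sum>j\<in>UNIV. mconst (A $ Some i $ Some j) * (mvar i * nabla p j f))" for i
      by (rule sum.remove[symmetric]) auto
    ultimately show ?thesis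
      by (simp flip: sum.distrib)
  qed
  show ?thesis
    unfolding M_act_def diag qcoef_act
    by (simp add: sum_UNIV_option sum.distrib mscale_def sum_negf flip: offdiag)
qed

section \<open>The module axioms for M(p)\<close>

lemma vector_space_mscale: "vector_space (mscale :: 'a::field \<Rightarrow> ('n, 'a) mpoly \<Rightarrow> ('n, 'a) mpoly)"
  by unfold_locales (simp_all add: mscale_def mconst_add mconst_mult algebra_simps)

lemma sl_add: "A \<in> sl \<Longrightarrow> B \<in> sl \<Longrightarrow> A + B \<in> sl"
  by (simp add: sl_def trace_add)

lemma sl_scale: "A \<in> sl \<Longrightarrow> (\<chi> i j. c * A $ i $ j) \<in> sl"
  by (simp add: sl_def trace_def flip: sum_distrib_left)

lemma sl_lie_bracket: "lie_bracket A B \<in> sl"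
  by (simp add: sl_def lie_bracket_def trace_sub trace_mul_sym[of A])

lemma M_act_bracket:
  fixes p f :: "('n::finite, 'a::field_char_0) mpoly"
  assumes "A \<in> sl" "B \<in> sl"
  shows "M_act p (lie_bracket A B) f = M_act p A (M_act p B f) - M_act p B (M_act p A f)"
proof -
  let ?T = "unit_act p" and ?a = "\<lambda>a b. mconst (A $ a $ b)" and ?b = "\<lambda>a b. mconst (B $ a $ b)"
  have comp: "M_act p A (M_act p B f) =
      (\<Sum>a\<in>UNIV. \<Sum>b\<in>UNIV. \<Sum>c\<in>UNIV. \<Sum>d\<in>UNIV. mconst (A $ a $ b) * mconst (B $ c $ d) * ?T a b (?T c d f))"
    if "A \<in> sl" "B \<in> sl" for A B
    using that by (simp add: M_act_eq unit_act_sum unit_act_mconst_mult sum_distrib_left mult.assoc)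
  have swap: "(\<Sum>a\<in>UNIV. \<Sum>b\<in>UNIV. \<Sum>c\<in>UNIV. \<Sum>d\<in>UNIV. g a b c d) =
     (\<Sum>c\<in>UNIV. \<Sum>d\<in>UNIV. \<Sum>a\<in>UNIV. \<Sum>b\<in>UNIV. (g a b c d :: ('n, 'a) mpoly))"
    for g :: "'n option \<Rightarrow> 'n option \<Rightarrow> 'n option \<Rightarrow> 'n option \<Rightarrow> ('n, 'a) mpoly"
  proof -
    have rot: "(\<Sum>a\<in>UNIV. \<Sum>b\<in>UNIV. \<Sum>c\<in>UNIV. h a b c) =
      (\<Sum>c\<in>UNIV. \<Sum>a\<in>UNIV. \<Sum>b\<in>UNIV. h a b c)"
      for h :: "'n option \<Rightarrow> 'n option \<Rightarrow> 'n option \<Rightarrow> ('n, 'a) mpoly"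
    proof -
      have "(\<Sum>b\<in>UNIV. \<Sum>c\<in>UNIV. h a b c) = (\<Sum>c\<in>UNIV. \<Sum>b\<in>UNIV. h a b c)" for a
        by (rule sum.swap)
      then show ?thesis by (simp add: sum.swap[of "\<lambda>a c. \<Sum>b\<in>UNIV. h a b c"])
    qed
    show ?thesis
      by (subst rot) (intro sum.cong refl rot)
  qed
  have delta: "(\<Sum>x\<in>UNIV. if P then (g x :: ('n, 'a) mpoly) else 0) = (if P then (\<Sum>x\<in>UNIV. g x) else 0)"
    for P and g :: "'n option \<Rightarrow> ('n, 'a) mpoly" by simp
  have "M_act p A (M_act p B f) - M_act p B (M_act p A f) =
     (\<Sum>a\<in>UNIV. \<Sum>b\<in>UNIV. \<Sum>c\<in>UNIV. \<Sum>d\<in>UNIV. ?a a b * ?b c d * (?T a b (?T c d f) - ?T c d (?T a b f)))"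
    using assms unfolding comp[OF assms] comp[OF assms(2,1)] swap[of "\<lambda>a b c d. ?b a b * ?a c d * ?T a b (?T c d f)"]
    by (simp add: right_diff_distrib sum_subtractf mult_ac)
  \<comment> \<open>The two deltas in the commutator of matrix units each collapse one summation.
    What remains are the entries of \<open>A ** B\<close> and \<open>B ** A\<close>.\<close>
  also have "\<dots> =
     (\<Sum>a\<in>UNIV. \<Sum>b\<in>UNIV. \<Sum>d\<in>UNIV. ?a a b * ?b b d * ?T a d f)
     - (\<Sum>a\<in>UNIV. \<Sum>b\<in>UNIV. \<Sum>c\<in>UNIV. ?a a b * ?b c a * ?T c b f)"
    by (simp add: unit_act_bracket right_diff_distrib sum_subtractf delta if_distrib[of "\<lambda>x. _ * x"] cong: if_cong)
  also have "(\<Sum>a\<in>UNIV. \<Sum>b\<in>UNIV. \<Sum>d\<in>UNIV. ?a a b * ?b b d * ?T a d f) =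
      (\<Sum>a\<in>UNIV. \<Sum>d\<in>UNIV. \<Sum>b\<in>UNIV. ?a a b * ?b b d * ?T a d f)"
    by (intro sum.cong refl sum.swap)
  also have "(\<Sum>a\<in>UNIV. \<Sum>b\<in>UNIV. \<Sum>c\<in>UNIV. ?a a b * ?b c a * ?T c b f) =
      (\<Sum>c\<in>UNIV. \<Sum>b\<in>UNIV. \<Sum>a\<in>UNIV. ?a a b * ?b c a * ?T c b f)"
    by (subst sum.swap, subst (2) sum.swap, subst sum.swap) simp
  also have "(\<Sum>a\<in>UNIV. \<Sum>d\<in>UNIV. \<Sum>b\<in>UNIV. ?a a b * ?b b d * ?T a d f) -
     (\<Sum>c\<in>UNIV. \<Sum>b\<in>UNIV. \<Sum>a\<in>UNIV. ?a a b * ?b c a * ?T c b f) = M_act p (lie_bracket A B) f"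
    unfolding M_act_eq[OF sl_lie_bracket]
    by (simp add: lie_bracket_def matrix_matrix_mult_def mconst_diff mconst_sum
        mconst_mult left_diff_distrib right_diff_distrib sum_subtractf sum_distrib_left sum_distrib_right mult_ac)
  finally show ?thesis by simp
qed

lemma sl_module_M_act:
  fixes p :: "('n::finite, 'a::field_char_0) mpoly"
  shows "sl_module mscale (M_act p)"
proof -
  show ?thesis
  proof (intro sl_module.intro sl_module_axioms.intro)
    show "vector_space (mscale :: 'a \<Rightarrow> ('n, 'a) mpoly \<Rightarrow> ('n, 'a) mpoly)"
      by (rule vector_space_mscale)
    fix A :: "'a ^ 'n option ^ 'n option"
    assume A: "A \<in> sl"
    show "Vector_Spaces.linear mscale mscale (M_act p A)"
      by (simp add: Vector_Spaces.linear_iff vector_space_mscale M_act_eq[OF A] mscale_def unit_act_add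
          unit_act_mconst_mult distrib_left sum.distrib sum_distrib_left mult.left_commute)
    show "M_act p (\<chi> i j. c * A $ i $ j) f = mscale c (M_act p A f)" for c f
      by (simp add: M_act_eq A sl_scale mscale_def mconst_mult sum_distrib_left mult.assoc)
    fix B :: "'a ^ 'n option ^ 'n option"
    assume B: "B \<in> sl"
    show "M_act p (A + B) f = M_act p A f + M_act p B f" for f
      by (simp add: M_act_eq A B sl_add mconst_add distrib_right sum.distrib)
    show "M_act p (lie_bracket A B) f = M_act p A (M_act p B f) - M_act p B (M_act p A f)" for f
      by (rule M_act_bracket[OF A B])
  qed
qed


section \<open>Units of the polynomial ring\<close>

lemma mult_eq_sum_single:
  "f * g = (\<Sum>k\<in>Poly_Mapping.keys f. \<Sum>l\<in>Poly_Mapping.keys g.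
     Poly_Mapping.single (k + l) (Poly_Mapping.lookup f k * Poly_Mapping.lookup (g :: ('n, 'a::comm_semiring_1) mpoly) l))"
  by (subst (1) sum_single_lookup[of f, symmetric], subst (1) sum_single_lookup[of g, symmetric])
    (simp only: sum_product mult_single)

text \<open>An injection of the variables into the natural numbers gives a monomial order, and the
  leading monomials of a unit and of its inverse add up to \<open>0\<close>.\<close>

lemma unit_imp_mconst:
  fixes u v :: "('n::finite, 'a::field) mpoly"
  assumes uv: "u * v = 1"
  shows "u = mconst (Poly_Mapping.lookup u 0)"
proof -
  obtain idx :: "'n \<Rightarrow> nat" where idx: "inj idx"
    using finite_imp_inj_to_nat_seg[OF finite[of "UNIV :: 'n set"]] by blast
  \<comment> \<open>The variable type carries no order. Renaming the variables by naturals gives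
    exponents with a linear order compatible with addition.\<close>
  define ord :: "('n \<Rightarrow>\<^sub>0 nat) \<Rightarrow> (nat \<Rightarrow>\<^sub>0 nat)" where
    "ord m = (\<Sum>i\<in>UNIV. Poly_Mapping.single (idx i) (Poly_Mapping.lookup m i))" for m
  have ord_add: "ord (m + m') = ord m + ord m'" for m m'
    by (simp add: ord_def lookup_add single_add sum.distrib)
  have "Poly_Mapping.lookup (ord m) (idx i) = Poly_Mapping.lookup m i" for m i
    by (simp add: ord_def lookup_sum lookup_single when_def inj_eq[OF idx])
  then have ord_inj: "m = m'" if "ord m = ord m'" for m m'
    by (metis that poly_mapping_eqI)
  have ord_zero: "ord 0 = 0"
    by (simp add: ord_def)
  have ord_nonneg: "0 \<le> ord m" for m
  proof -
    have "\<not> k < (0 :: nat \<Rightarrow>\<^sub>0 nat)" for k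
      by transfer (auto simp: less_fun_def)
    then show ?thesis by (simp add: not_less)
  qed
  have leading: "\<exists>m\<in>Poly_Mapping.keys f. \<forall>k\<in>Poly_Mapping.keys f. ord k \<le> ord m"
    if "f \<noteq> 0" for f :: "('n, 'a) mpoly"
  proof -
    have fin: "finite (ord ` Poly_Mapping.keys f)" and ne: "ord ` Poly_Mapping.keys f \<noteq> {}"
      using that by simp_all
    from Max_in[OF this] obtain m where "m \<in> Poly_Mapping.keys f" "Max (ord ` Poly_Mapping.keys f) = ord m"
      by auto
    then show ?thesis using Max_ge[OF fin] by (metis imageI)
  qed
  from uv have "u \<noteq> 0" "v \<noteq> 0" by auto
  with leading obtain m l where
    m: "m \<in> Poly_Mapping.keys u" "\<And>k. k \<in> Poly_Mapping.keys u \<Longrightarrow> ord k \<le> ord m" and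
    l: "l \<in> Poly_Mapping.keys v" "\<And>k. k \<in> Poly_Mapping.keys v \<Longrightarrow> ord k \<le> ord l"
    by meson
  \<comment> \<open>By strict monotonicity of addition, only the two leading exponents can add up to
    \<open>m + l\<close>, so nothing cancels the product of their coefficients.\<close>
  have unique: "k + k' = m + l \<longleftrightarrow> k = m \<and> k' = l"
    if "k \<in> Poly_Mapping.keys u" "k' \<in> Poly_Mapping.keys v" for k k'
  proof
    assume "k + k' = m + l"
    then have eq: "ord k + ord k' = ord m + ord l" by (simp flip: ord_add)
    have le: "ord k \<le> ord m" "ord k' \<le> ord l" using m(2) l(2) that by auto
    have "ord k = ord m"
    proof (rule ccontr)
      assume "ord k \<noteq> ord m"
      with le have "ord k < ord m" by simp
      then have "ord k + ord k' < ord m + ord l" using le(2) by (rule add_less_le_mono)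
      with eq show False by simp
    qed
    with eq have "ord k' = ord l" by simp
    with \<open>ord k = ord m\<close> show "k = m \<and> k' = l" by (simp add: ord_inj)
  qed simp
  have "Poly_Mapping.lookup (u * v) (m + l) = (\<Sum>k\<in>Poly_Mapping.keys u. \<Sum>k'\<in>Poly_Mapping.keys v.
      if k + k' = m + l then Poly_Mapping.lookup u k * Poly_Mapping.lookup v k' else 0)"
    by (subst mult_eq_sum_single) (simp add: lookup_sum lookup_single when_def)
  also have "\<dots> = (\<Sum>k\<in>Poly_Mapping.keys u. \<Sum>k'\<in>Poly_Mapping.keys v.
      if k = m then (if k' = l then Poly_Mapping.lookup u k * Poly_Mapping.lookup v k' else 0) else 0)"
    by (intro sum.cong refl) (use unique in auto)
  also have "\<dots> = (\<Sum>k\<in>Poly_Mapping.keys u. if k = m then Poly_Mapping.lookup u m * Poly_Mapping.lookup v l else 0)"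
    using l(1) by (intro sum.cong refl) simp
  also have "\<dots> = Poly_Mapping.lookup u m * Poly_Mapping.lookup v l"
    using m(1) by simp
  finally have "Poly_Mapping.lookup (u * v) (m + l) \<noteq> 0"
    using m(1) l(1) by (simp add: in_keys_iff)
  then have "m + l = 0" by (simp add: uv lookup_one when_def split: if_splits)
  then have "m = 0" by (metis add_is_0 lookup_add lookup_zero poly_mapping_eqI)
  \<comment> \<open>Every exponent of \<open>u\<close> is squeezed between 0 and the leading
    exponent, which is 0.\<close>
  have "k = 0" if "k \<in> Poly_Mapping.keys u" for k
  proof -
    from m(2)[OF that] have "ord k = 0"
      using ord_nonneg[of k] by (simp add: \<open>m = 0\<close> ord_zero)
    then show ?thesis using ord_inj[of k 0] ord_zero by simp
  qed
  then show ?thesis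
    by (intro poly_mapping_eqI) (metis in_keys_iff lookup_mconst)
qed


section \<open>A basis of \<open>sl\<^bsub>n+1\<^esub>\<close>\<close>

lemma trace_matrix_unit: "trace (matrix_unit a b) = (if a = b then 1 else 0)"
  by (cases "a = b") (auto simp: trace_def matrix_unit_def intro!: sum.neutral)

lemma matrix_unit_mult: "matrix_unit a b ** matrix_unit c d = (if b = c then matrix_unit a d else 0 :: 'a::comm_ring_1 ^ 'k::finite ^ 'k)"
proof -
  have "(\<Sum>k\<in>UNIV. (if i = a \<and> k = b then 1 else 0) * (if k = c \<and> j = d then 1 else 0)) =
      (if b = c \<and> i = a \<and> j = d then 1 else 0 :: 'a)" for i j
  proof -
    have "(\<Sum>k\<in>UNIV. (if i = a \<and> k = b then 1 else 0) * (if k = c \<and> j = d then 1 else 0)) =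
      (\<Sum>k\<in>UNIV. if k = b then (if b = c \<and> i = a \<and> j = d then 1 else 0 :: 'a) else 0)"
      by (intro sum.cong refl) auto
    then show ?thesis by simp
  qed
  then show ?thesis
    by (simp add: vec_eq_iff matrix_matrix_mult_def matrix_unit_def)
qed

lemma lie_bracket_matrix_unit:
  "lie_bracket (matrix_unit a b) (matrix_unit c d :: 'a::comm_ring_1 ^ 'k::finite ^ 'k) =
     (if b = c then matrix_unit a d else 0) - (if a = d then matrix_unit c b else 0)"
  by (auto simp: lie_bracket_def matrix_unit_mult)

text \<open>The image of a matrix unit of gl_n in sl_{n+1}, made traceless by a scalar matrix. It
  treats h_i (for i = j) and e_ij (otherwise) uniformly, with the bracket relations of gl_n.\<close>

definition gl_unit :: "'n::finite \<Rightarrow> 'n \<Rightarrow> 'a::field ^ 'n option ^ 'n option" where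
  "gl_unit i j = matrix_unit (Some i) (Some j) - (if i = j then mat (1 / of_nat (CARD('n) + 1)) else 0)"

lemma cartan_eq_gl_unit: "cartan i = gl_unit i i"
  by (simp add: cartan_def gl_unit_def)

lemma matrix_unit_in_sl: "a \<noteq> b \<Longrightarrow> matrix_unit a b \<in> sl"
  by (simp add: sl_def trace_matrix_unit)

lemma gl_unit_in_sl: "(gl_unit i j :: 'a::field_char_0 ^ 'n option ^ 'n::finite option) \<in> sl"
proof -
  have "of_nat (CARD('n) + 1) \<noteq> (0 :: 'a)" by (simp only: of_nat_eq_0_iff)
  moreover have "trace (mat x :: 'a ^ 'n option ^ 'n option) = of_nat (CARD('n) + 1) * x" for x
    by (simp add: trace_def mat_def card_option)
  moreover have "trace (0 :: 'a ^ 'n option ^ 'n option) = 0"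
    by (simp add: trace_def)
  ultimately show ?thesis
    by (simp only: sl_def gl_unit_def trace_sub trace_matrix_unit mem_Collect_eq) auto
qed

lemma lie_bracket_mat:
  fixes A B :: "'a::comm_ring_1 ^ 'k::finite ^ 'k"
  shows "lie_bracket (A - mat c) B = lie_bracket A B" "lie_bracket A (B - mat c) = lie_bracket A B"
proof -
  have "mat c ** B = (\<chi> i j. c * B $ i $ j)" "B ** mat c = (\<chi> i j. c * B $ i $ j)" for B :: "'a ^ 'k ^ 'k"
    by (simp_all add: vec_eq_iff matrix_matrix_mult_def mat_def if_distrib[of "\<lambda>x. x * _"]
        if_distrib[of "\<lambda>x. _ * x"] mult.commute cong: if_cong)
  moreover have "(A - C) ** B = A ** B - C ** B" "A ** (B - C) = A ** B - A ** C" for A B C :: "'a ^ 'k ^ 'k"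
    by (simp_all add: vec_eq_iff matrix_matrix_mult_def left_diff_distrib right_diff_distrib sum_subtractf)
  ultimately show "lie_bracket (A - mat c) B = lie_bracket A B" "lie_bracket A (B - mat c) = lie_bracket A B"
    by (simp_all add: lie_bracket_def)
qed

lemma lie_bracket_gl_unit_left: "lie_bracket (gl_unit i j) B = lie_bracket (matrix_unit (Some i) (Some j)) B"
  by (simp add: gl_unit_def lie_bracket_mat)

lemma lie_bracket_gl_unit:
  "lie_bracket (gl_unit i j) (gl_unit k l) =
     (if j = k then gl_unit i l else 0) - (if i = l then gl_unit k j else 0)"
proof -
  have "lie_bracket (gl_unit i j) (gl_unit k l) =
      lie_bracket (matrix_unit (Some i) (Some j)) (matrix_unit (Some k) (Some l))"
    by (simp add: gl_unit_def lie_bracket_mat)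
  then show ?thesis
    by (auto simp: lie_bracket_matrix_unit gl_unit_def)
qed

text \<open>The sum of the h_r is I/(n+1) - e_{n+1,n+1}. Hence these brackets lie in the span of the
  \<open>gl_unit i j\<close>, where the action is settled first.\<close>

lemma lie_bracket_raise_lower:
  "lie_bracket (matrix_unit (Some k) None) (matrix_unit None (Some i)) =
     gl_unit k i + (if k = i then \<Sum>r\<in>UNIV. gl_unit r r else 0 :: 'a::field_char_0 ^ 'n option ^ 'n::finite option)"
proof -
  define N :: 'a where "N = of_nat (CARD('n))"
  have N: "N + 1 \<noteq> 0"
    unfolding N_def by (metis of_nat_Suc of_nat_eq_0_iff nat.distinct(1) add.commute)
  have "(\<Sum>r\<in>UNIV. gl_unit r r) = mat (1 / (N + 1)) - (matrix_unit None None :: 'a ^ 'n option ^ 'n option)"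
  proof -
    have "(\<Sum>r\<in>UNIV. if a = Some r \<and> b = Some r then 1 else 0) =
        (if a = b \<and> a \<noteq> None then 1 else 0 :: 'a)" for a b :: "'n option"
      by (cases a; cases b) (auto intro!: sum.neutral)
    moreover have "(\<Sum>r\<in>UNIV. gl_unit r r) $ a $ b =
        (\<Sum>r\<in>UNIV. (if a = Some r \<and> b = Some r then 1 else 0) - (if a = b then 1 / (N + 1) else 0))"
      for a b :: "'n option"
      unfolding sum_component
      by (intro sum.cong refl) (simp add: gl_unit_def matrix_unit_def mat_def N_def)
    ultimately have entry: "(\<Sum>r\<in>UNIV. gl_unit r r) $ a $ b =
        (if a = b \<and> a \<noteq> None then 1 else 0) - N * (if a = b then 1 / (N + 1) else 0)" for a b :: "'n option"
      by (simp only: sum_subtractf sum_constant N_def)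
    show ?thesis
      unfolding vec_eq_iff vector_minus_component entry
      using N by (auto simp: matrix_unit_def mat_def field_simps)
  qed
  then show ?thesis
    by (simp add: lie_bracket_matrix_unit gl_unit_def N_def add.commute[of 1])
qed

lemma sl_decomposition:
  fixes A :: "'a::field_char_0 ^ 'n option ^ 'n::finite option"
  assumes "A \<in> sl"
  shows "A = (\<Sum>i\<in>UNIV. \<chi> k l. A $ Some i $ None * matrix_unit (Some i) None $ k $ l)
    + (\<Sum>i\<in>UNIV. \<Sum>j\<in>UNIV. \<chi> k l. (A $ Some i $ Some j - (if i = j then A $ None $ None else 0)) * gl_unit i j $ k $ l)
    + (\<Sum>i\<in>UNIV. \<chi> k l. A $ None $ Some i * matrix_unit None (Some i) $ k $ l)"
proof -
  have tr: "(\<Sum>i\<in>UNIV. A $ Some i $ Some i) = - A $ None $ None"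
    using assms by (simp add: sl_def trace_def sum_UNIV_option eq_neg_iff_add_eq_0 add.commute)
  define N :: 'a where "N = of_nat (CARD('n))"
  have N: "N + 1 \<noteq> 0"
    unfolding N_def by (metis of_nat_Suc of_nat_eq_0_iff nat.distinct(1) add.commute)
  let ?c = "\<lambda>i j. A $ Some i $ Some j - (if i = j then A $ None $ None else 0)"
  \<comment> \<open>Tracelessness enters here. With \<open>x\<close> = 1/(n+1), the scalar parts of
    the h_i restore the entry A_{n+1,n+1} along the whole diagonal.\<close>
  have diag: "(\<Sum>i\<in>UNIV. \<Sum>j\<in>UNIV. ?c i j * (if i = j then x else 0)) = - (N + 1) * A $ None $ None * x" for x
  proof -
    have "(\<Sum>j\<in>UNIV. ?c i j * (if i = j then x else 0)) = (A $ Some i $ Some i - A $ None $ None) * x" for i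
    proof -
      have "(\<Sum>j\<in>UNIV. ?c i j * (if i = j then x else 0)) =
          (\<Sum>j\<in>UNIV. if i = j then (A $ Some i $ Some i - A $ None $ None) * x else 0)"
        by (intro sum.cong refl) auto
      then show ?thesis by simp
    qed
    then have "(\<Sum>i\<in>UNIV. \<Sum>j\<in>UNIV. ?c i j * (if i = j then x else 0)) =
        (\<Sum>i\<in>UNIV. A $ Some i $ Some i - A $ None $ None) * x"
      by (simp only: sum_distrib_right)
    also have "\<dots> = - (N + 1) * A $ None $ None * x"
      by (simp add: sum_subtractf tr N_def algebra_simps)
    finally show ?thesis .
  qed
  have block: "(\<Sum>i\<in>UNIV. \<Sum>j\<in>UNIV. ?c i j * gl_unit i j $ a $ b) =
     (\<Sum>i\<in>UNIV. \<Sum>j\<in>UNIV. if a = Some i \<and> b = Some j then ?c i j else 0) + (if a = b then A $ None $ None else 0)"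
    for a b
  proof -
    have "(\<Sum>i\<in>UNIV. \<Sum>j\<in>UNIV. ?c i j * gl_unit i j $ a $ b) =
       (\<Sum>i\<in>UNIV. \<Sum>j\<in>UNIV. if a = Some i \<and> b = Some j then ?c i j else 0)
       - (\<Sum>i\<in>UNIV. \<Sum>j\<in>UNIV. ?c i j * (if i = j then if a = b then 1 / (N + 1) else 0 else 0))"
      unfolding sum_subtractf[symmetric]
      by (intro sum.cong refl) (auto simp: gl_unit_def matrix_unit_def mat_def algebra_simps simp flip: N_def)
    moreover have "- (N + 1) * A $ None $ None * (if a = b then 1 / (N + 1) else 0) =
        - (if a = b then A $ None $ None else 0)"
    proof -
      have "- (N + 1) * A $ None $ None * (1 / (N + 1)) = - (A $ None $ None * ((N + 1) * (1 / (N + 1))))"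
        by (simp only: mult_ac mult_minus_left mult_minus_right)
      also have "(N + 1) * (1 / (N + 1)) = 1" using N by simp
      finally show ?thesis by simp
    qed
    ultimately show ?thesis
      unfolding diag by simp
  qed
  have [simp]: "(\<Sum>i\<in>UNIV. \<Sum>j\<in>UNIV. if a = i \<and> b = j then g i j else 0) = (g a b :: 'a)"
    for a b :: 'n and g
  proof -
    have "(\<Sum>j\<in>UNIV. if a = i \<and> b = j then g i j else 0) = (if a = i then g i b else 0)" for i
      by (cases "a = i") simp_all
    then show ?thesis by simp
  qed
  show ?thesis
  proof (unfold vec_eq_iff, intro allI)
    fix a b
    show "A $ a $ b = ((\<Sum>i\<in>UNIV. \<chi> k l. A $ Some i $ None * matrix_unit (Some i) None $ k $ l)
      + (\<Sum>i\<in>UNIV. \<Sum>j\<in>UNIV. \<chi> k l. ?c i j * gl_unit i j $ k $ l)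
      + (\<Sum>i\<in>UNIV. \<chi> k l. A $ None $ Some i * matrix_unit None (Some i) $ k $ l)) $ a $ b"
      by (cases a; cases b)
        (simp_all add: block, simp_all add: matrix_unit_def if_distrib[of "\<lambda>x. _ * x"] cong: if_cong)
  qed
qed

lemma sl_induct [consumes 1, case_names add scale raise gl lower]:
  fixes A :: "'a::field_char_0 ^ 'n option ^ 'n::finite option"
  assumes "A \<in> sl"
    and add: "\<And>A B. A \<in> sl \<Longrightarrow> B \<in> sl \<Longrightarrow> P A \<Longrightarrow> P B \<Longrightarrow> P (A + B)"
    and scale: "\<And>c A. A \<in> sl \<Longrightarrow> P A \<Longrightarrow> P (\<chi> i j. c * A $ i $ j)"
    and raise: "\<And>i. P (matrix_unit (Some i) None)"
    and gl: "\<And>i j. P (gl_unit i j)"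
    and lower: "\<And>i. P (matrix_unit None (Some i))"
  shows "P A"
proof -
  define Q where "Q A \<longleftrightarrow> A \<in> sl \<and> P A" for A
  have Q_add: "Q (A + B)" if "Q A" "Q B" for A B
    using that add sl_add by (auto simp: Q_def)
  have Q_scale: "Q (\<chi> i j. c * A $ i $ j)" if "Q A" for c A
    using that scale sl_scale by (auto simp: Q_def)
  have Q_gen: "Q (matrix_unit (Some i) None)" "Q (gl_unit i j)" "Q (matrix_unit None (Some i))" for i j
    using raise gl lower by (auto simp: Q_def gl_unit_in_sl matrix_unit_in_sl)
  have Q_zero: "Q 0"
    using Q_scale[OF Q_gen(2), of 0] by (simp add: zero_vec_def)
  have Q_sum: "Q (\<Sum>x\<in>X. g x)" if "\<And>x. Q (g x)" for g and X :: "'n set"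
    by (induction X rule: infinite_finite_induct) (auto intro: Q_zero Q_add that)
  have "Q A"
    by (subst sl_decomposition[OF assms(1)]) (intro Q_add Q_sum Q_scale Q_gen)
  then show ?thesis by (simp add: Q_def)
qed


section \<open>The action of the basis on \<open>M(p)\<close>\<close>

lemma M_act_matrix_unit:
  fixes p f :: "('n::finite, 'a::field_char_0) mpoly"
  assumes "a \<noteq> b"
  shows "M_act p (matrix_unit a b) f = unit_act p a b f"
proof -
  have "M_act p (matrix_unit a b) f =
      (\<Sum>c\<in>UNIV. \<Sum>d\<in>UNIV. if c = a then (if d = b then unit_act p a b f else 0) else 0)"
    unfolding M_act_eq[OF matrix_unit_in_sl[OF assms]]
    by (intro sum.cong refl) (auto simp: matrix_unit_def)
  also have "\<dots> = (\<Sum>c\<in>UNIV. if c = a then unit_act p a b f else 0)"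
    by (intro sum.cong refl) simp
  finally show ?thesis by simp
qed

lemma M_act_gl_unit:
  fixes p f :: "('n::finite, 'a::field_char_0) mpoly"
  shows "M_act p (gl_unit i j) f = pcoef p i j * f + mvar i * mderiv j f"
proof (cases "i = j")
  case False
  then show ?thesis
    by (simp add: gl_unit_def M_act_matrix_unit pcoef_act)
next
  case True
  define N :: 'a where "N = of_nat (CARD('n) + 1)"
  have N: "N \<noteq> 0"
    unfolding N_def by (simp only: of_nat_eq_0_iff)
  have inner: "(\<Sum>d\<in>UNIV. mconst ((gl_unit i i :: 'a ^ 'n option ^ 'n option) $ c $ d) * unit_act p c d f) =
      (if c = Some i then unit_act p c c f else 0) - mconst (1 / N) * unit_act p c c f" for c
  proof -
    have "(\<Sum>d\<in>UNIV. mconst ((gl_unit i i :: 'a ^ 'n option ^ 'n option) $ c $ d) * unit_act p c d f) =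
      (\<Sum>d\<in>UNIV. if c = d then (if c = Some i then unit_act p c c f else 0) - mconst (1 / N) * unit_act p c c f else 0)"
      by (intro sum.cong refl)
        (auto simp: gl_unit_def matrix_unit_def mat_def mconst_diff left_diff_distrib N_def)
    then show ?thesis by simp
  qed
  have "(\<Sum>r\<in>UNIV. mvar r * nabla p r f) = euler f + euler p * f"
    by (simp add: nabla_def euler_def distrib_left sum.distrib sum_distrib_right mult.assoc)
  \<comment> \<open>The identity of gl_{n+1} acts by the scalar -(n + 1) \<open>pconst p\<close>.
    Subtracting I/(n+1) from e_ii therefore adds \<open>pconst p\<close>.\<close>
  then have center: "(\<Sum>c\<in>UNIV. unit_act p c c f) = - mconst (N * pconst p) * f"
    unfolding sum_UNIV_option N_def by (simp add: shifted_euler_def algebra_simps)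
  have "M_act p (gl_unit i i) f = unit_act p (Some i) (Some i) f - mconst (1 / N) * (\<Sum>c\<in>UNIV. unit_act p c c f)"
    unfolding M_act_eq[OF gl_unit_in_sl] inner by (simp add: sum_subtractf flip: sum_distrib_left)
  also have "mconst (1 / N) * (\<Sum>c\<in>UNIV. unit_act p c c f) = - mconst (1 / N * (N * pconst p)) * f"
    unfolding center mconst_mult by (simp add: mult.assoc)
  finally show ?thesis
    using N True by (simp add: pcoef_act)
qed


section \<open>Modules on which \<open>x\<^sub>i\<close> acts by multiplication\<close>

text \<open>An endomorphism of the regular module is multiplication by its value at 1, and linearity
  need only be checked on constants and variables.\<close>

lemma module_endo_eq_mult:
  fixes Z :: "('n, 'a::comm_semiring_1) mpoly \<Rightarrow> ('n, 'a) mpoly"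
  assumes add: "\<And>f g. Z (f + g) = Z f + Z g"
    and const: "\<And>c f. Z (mconst c * f) = mconst c * Z f"
    and var: "\<And>i f. Z (mvar i * f) = mvar i * Z f"
  shows "Z f = f * Z 1"
proof (induction f rule: mpoly_induct)
  case (const c)
  show ?case using assms(2)[of c 1] by simp
qed (simp_all add: add var mult.assoc distrib_right)

lemma lookup_mvar_mult_0 [simp]: "Poly_Mapping.lookup (mvar i * f :: ('n, 'a::comm_semiring_1) mpoly) 0 = 0"
  by (simp add: lookup_mvar_mult)

text \<open>In characteristic 0 each coefficient of positive degree can be divided by that degree.
  The constant term of \<open>t\<close> is not in the image, and that of \<open>p\<close> is free,
  so it is chosen to agree with \<open>t\<close>.\<close>

lemma exists_euler_preimage:
  fixes t :: "('n::finite, 'a::field_char_0) mpoly"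
  obtains p where "Poly_Mapping.lookup p 0 = Poly_Mapping.lookup t 0"
    "euler p = t - mconst (Poly_Mapping.lookup t 0)"
proof -
  define d where "d m = (\<Sum>i\<in>UNIV. Poly_Mapping.lookup m i)" for m :: "'n \<Rightarrow>\<^sub>0 nat"
  have d: "d m \<noteq> 0" if "m \<noteq> 0" for m
    using that unfolding d_def by (metis finite UNIV_I lookup_zero poly_mapping_eqI sum_eq_0_iff)
  have d0: "d 0 = 0" by (simp add: d_def)
  define p where "p = Poly_Mapping.mapp (\<lambda>m c. if m = 0 then c else c / of_nat (d m)) t"
  have lookup_p: "Poly_Mapping.lookup p m =
      (if m = 0 then Poly_Mapping.lookup t m else Poly_Mapping.lookup t m / of_nat (d m))" for m
    by (auto simp: p_def lookup_mapp in_keys_iff when_def)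
  have "euler p = t - mconst (Poly_Mapping.lookup t 0)"
  proof (rule poly_mapping_eqI)
    fix m
    show "Poly_Mapping.lookup (euler p) m = Poly_Mapping.lookup (t - mconst (Poly_Mapping.lookup t 0)) m"
      using d[of m] unfolding lookup_euler d_def[symmetric] lookup_minus lookup_mconst lookup_p
      by (cases "m = 0") (simp_all add: d0)
  qed
  then show ?thesis using that lookup_p[of 0] by simp
qed

lemma euler_eq_0_imp_mconst:
  fixes f :: "('n::finite, 'a::field_char_0) mpoly"
  assumes "euler f = 0"
  shows "f = mconst (Poly_Mapping.lookup f 0)"
proof (rule poly_mapping_eqI)
  fix m
  show "Poly_Mapping.lookup f m = Poly_Mapping.lookup (mconst (Poly_Mapping.lookup f 0)) m"
  proof (cases "m = 0")
    case False
    then have "(\<Sum>i\<in>UNIV. Poly_Mapping.lookup m i) \<noteq> 0"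
      by (metis finite UNIV_I lookup_zero poly_mapping_eqI sum_eq_0_iff)
    then have "Poly_Mapping.lookup f m = 0"
      using lookup_euler[of f m] unfolding assms lookup_zero
      by (metis mult_eq_0_iff of_nat_eq_0_iff)
    with False show ?thesis by (simp add: lookup_mconst)
  qed (simp add: lookup_mconst)
qed

text \<open>\<open>P i j + x\<^sub>i \<partial>\<^sub>j\<close> satisfies the relations of \<open>gl\<^sub>n\<close> iff \<open>P\<close> is a cocycle. Taking \<open>k = l\<close>
  and summing shows that \<open>euler\<close> kills the class of \<open>P\<close>, so only its degree-\<open>0\<close> part is not a
  coboundary.\<close>

lemma gl_cocycle_eq_pcoef:
  fixes P :: "'n::finite \<Rightarrow> 'n \<Rightarrow> ('n, 'a::field_char_0) mpoly"
  assumes cocycle: "\<And>i j k l. mvar i * mderiv j (P k l) - mvar k * mderiv l (P i j) =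
    (if j = k then P i l else 0) - (if i = l then P k j else 0)"
  obtains p where "\<And>i j. P i j = pcoef p i j"
proof -
  define t where "t = (\<Sum>r\<in>UNIV. P r r)"
  have euler_P: "euler (P i j) = mvar i * mderiv j t" for i j
  proof -
    have "(\<Sum>r\<in>UNIV. mvar i * mderiv j (P r r) - mvar r * mderiv r (P i j)) = 0"
      unfolding cocycle by (simp add: sum_subtractf)
    then show ?thesis
      by (simp add: sum_subtractf t_def mderiv_sum euler_def sum_distrib_left)
  qed
  obtain p where p0: "Poly_Mapping.lookup p 0 = Poly_Mapping.lookup t 0"
    and euler_p: "euler p = t - mconst (Poly_Mapping.lookup t 0)"
    by (rule exists_euler_preimage)
  define c where "c i j = Poly_Mapping.lookup (P i j) 0" for i j
  have P_c: "P i j = mvar i * mderiv j p + mconst (c i j)" for i j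
  proof -
    have "euler (P i j - mvar i * mderiv j p) = mvar i * (mderiv j t - mderiv j (euler p))"
      by (simp add: euler_diff euler_mult euler_P mderiv_euler algebra_simps)
    also have "\<dots> = 0"
      by (simp add: euler_p mderiv_diff)
    finally show ?thesis
      using euler_eq_0_imp_mconst[of "P i j - mvar i * mderiv j p"]
      by (simp add: c_def lookup_minus algebra_simps)
  qed
  \<comment> \<open>Both terms on the left of the cocycle relation are multiples of variables, so
    they have no constant term.\<close>
  have c_eq: "(if j = k then c i l else 0) - (if i = l then c k j else 0) = 0" for i j k l
    using arg_cong[OF cocycle[of i j k l], of "\<lambda>f. Poly_Mapping.lookup f 0"]
    by (simp add: lookup_minus c_def split: if_splits)
  have off: "c i l = 0" if "i \<noteq> l" for i l
    using c_eq[of l l i l] c_eq[of i i i l] that by auto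
  \<comment> \<open>This is the relation with its two index conditions both satisfied. The common
    value is then the mean of the \<open>c r r\<close>, namely p(0)/n.\<close>
  have "c i i = c k k" for i k
    using c_eq[of k k i i] by simp
  then have "(\<Sum>r\<in>UNIV. c r r) = of_nat CARD('n) * c i i" for i
    by (metis (no_types, lifting) sum.cong sum_constant)
  moreover have "(\<Sum>r\<in>UNIV. c r r) = Poly_Mapping.lookup p 0"
    by (simp add: p0 t_def lookup_sum c_def)
  moreover have "of_nat CARD('n) \<noteq> (0 :: 'a)" by simp
  ultimately have "c i i = pconst p" for i
    by (simp add: pconst_def eq_divide_eq mult.commute)
  with off have "P i j = pcoef p i j" for i j
    by (simp add: P_c[of i j] pcoef_eq)
  then show ?thesis using that by blast
qed

section \<open>Recovering \<open>p\<close> from an action on polynomials\<close>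

lemma (in sl_module) act_diff_right: "A \<in> sl \<Longrightarrow> act A (v - w) = act A v - act A w"
  by (rule module_hom.diff[OF act_linear[folded module_hom_iff_linear]])

lemma (in sl_module) act_zero: "act 0 v = 0"
proof -
  have "0 \<in> sl" by (simp add: sl_def trace_def)
  from act_scale[OF this, of 0 v] show ?thesis by (simp add: zero_vec_def)
qed

lemma (in sl_module) act_minus:
  assumes "A \<in> sl"
  shows "act (- A) v = - act A v"
proof -
  have "(\<chi> i j. - 1 * A $ i $ j) = - A" by (simp add: vec_eq_iff)
  with act_scale[OF assms, of "- 1" v] show ?thesis by simp
qed

lemma (in sl_module) act_diff:
  assumes "A \<in> sl" "B \<in> sl"
  shows "act (A - B) v = act A v - act B v"
proof -
  have "- B \<in> sl" using assms(2) by (simp add: sl_def trace_def sum_negf)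
  with act_add[OF assms(1) this] act_minus[OF assms(2)] show ?thesis by simp
qed

lemma (in sl_module) act_swap:
  assumes "A \<in> sl" "B \<in> sl"
  shows "act A (act B v) = act B (act A v) + act (lie_bracket A B) v"
  by (simp add: act_bracket[OF assms])

lemma sl_module_mult_eq_M_act:
  fixes act :: "'a::field_char_0 ^ 'n option ^ 'n::finite option \<Rightarrow> ('n, 'a) mpoly \<Rightarrow> ('n, 'a) mpoly"
  assumes "sl_module mscale act"
    and raise: "\<And>i f. act (matrix_unit (Some i) None) f = mvar i * f"
  obtains p where "\<And>A f. A \<in> sl \<Longrightarrow> act A f = M_act p A f"
proof -
  interpret sl_module mscale act by fact
  note [simp] = gl_unit_in_sl matrix_unit_in_sl
  have act_plus: "act A (f + g) = act A f + act A g"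
    and act_const: "act A (mconst c * f) = mconst c * act A f" if "A \<in> sl" for A f g c
    using act_linear[OF that] by (simp_all add: Vector_Spaces.linear_iff mscale_def)

  define P where "P i j = act (gl_unit i j) 1" for i j
  have act_gl: "act (gl_unit i j) f = P i j * f + mvar i * mderiv j f" for i j f
  proof -
    \<comment> \<open>The bracket of \<open>gl_unit i j\<close> with e_{k,n+1} produces exactly the
      Leibniz term of x_i d/dx_j, so the difference commutes with every x_k.\<close>
    let ?Z = "\<lambda>f. act (gl_unit i j) f - mvar i * mderiv j f"
    have "?Z (mvar k * f) = mvar k * ?Z f" for k f
    proof -
      have "act (gl_unit i j) (mvar k * f) = mvar k * act (gl_unit i j) f + (if j = k then mvar i * f else 0)"
        using act_swap[of "gl_unit i j" "matrix_unit (Some k) None" f]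
        by (simp add: raise lie_bracket_gl_unit_left lie_bracket_matrix_unit act_zero)
      then show ?thesis
        by (simp add: mderiv_mult algebra_simps)
    qed
    then have "?Z f = f * ?Z 1"
      by (intro module_endo_eq_mult)
        (simp_all add: act_plus act_const mderiv_add mderiv_mconst_mult distrib_left right_diff_distrib
          mult.left_commute)
    then show ?thesis
      by (simp add: P_def algebra_simps)
  qed
  have "mvar i * mderiv j (P k l) - mvar k * mderiv l (P i j) =
      (if j = k then P i l else 0) - (if i = l then P k j else 0)" for i j k l
  proof -
    \<comment> \<open>Evaluated at 1, the commutator loses the products of the two \<open>P\<close>
      terms and leaves the cocycle relation.\<close>
    have "act (lie_bracket (gl_unit i j) (gl_unit k l)) 1 =
        (if j = k then P i l else 0) - (if i = l then P k j else 0)"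
      by (simp add: lie_bracket_gl_unit act_diff act_zero act_minus P_def)
    then show ?thesis
      unfolding act_bracket[OF gl_unit_in_sl gl_unit_in_sl] P_def[symmetric]
      by (simp add: act_gl algebra_simps)
  qed
  then obtain p where p: "\<And>i j. P i j = pcoef p i j"
    by (rule gl_cocycle_eq_pcoef) blast

  interpret M: sl_module mscale "M_act p" by (rule sl_module_M_act)
  define agree where "agree A \<longleftrightarrow> A \<in> sl \<and> (\<forall>f. act A f = M_act p A f)" for A
  have agree_add: "agree (A + B)" if "agree A" "agree B" for A B
    using that by (auto simp: agree_def sl_add act_add M.act_add)
  have agree_gl: "agree (gl_unit i j)" for i j
    by (simp add: agree_def act_gl M_act_gl_unit p)
  have agree_raise: "agree (matrix_unit (Some i) None)" for i
    by (simp add: agree_def raise M_act_matrix_unit)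
  have agree_zero: "agree 0"
    by (simp add: agree_def act_zero M.act_zero sl_def trace_def)
  have "agree (\<Sum>r\<in>R. gl_unit r r)" for R :: "'n set"
    by (induction R rule: infinite_finite_induct) (auto intro: agree_zero agree_add agree_gl)
  then have agree_bracket: "agree (lie_bracket (matrix_unit (Some k) None) (matrix_unit None (Some i)))" for k i
    by (auto simp: lie_bracket_raise_lower intro: agree_add agree_gl)

  have agree_lower: "agree (matrix_unit None (Some i))" for i
  proof -
    let ?y = "matrix_unit None (Some i) :: 'a ^ 'n option ^ 'n option"
    let ?W = "\<lambda>f. act ?y f - M_act p ?y f"
    define w where "w = ?W 1"
    \<comment> \<open>Both actions agree on e_{k,n+1} and on its bracket with e_{n+1,i}, so their
      difference on e_{n+1,i} commutes with x_k.\<close>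
    have "?W (mvar k * f) = mvar k * ?W f" for k f
    proof -
      let ?x = "matrix_unit (Some k) None :: 'a ^ 'n option ^ 'n option"
      have "mvar k * act ?y f = act ?y (mvar k * f) + act (lie_bracket ?x ?y) f"
        using act_swap[of ?x ?y f] by (simp add: raise)
      moreover have "mvar k * M_act p ?y f = M_act p ?y (mvar k * f) + M_act p (lie_bracket ?x ?y) f"
        using M.act_swap[of ?x ?y f] by (simp add: M_act_matrix_unit)
      moreover have "act (lie_bracket ?x ?y) f = M_act p (lie_bracket ?x ?y) f"
        using agree_bracket by (simp add: agree_def)
      ultimately show ?thesis by (simp add: algebra_simps)
    qed
    then have W: "?W f = f * w" for f
      unfolding w_def
      by (intro module_endo_eq_mult)
        (simp_all add: act_plus act_const M_act_matrix_unit unit_act_add unit_act_mconst_mult distrib_left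
          right_diff_distrib del: unit_act.simps)
    let ?h = "gl_unit i i :: 'a ^ 'n option ^ 'n option"
    have bracket: "lie_bracket ?h ?y = - ?y"
      by (simp add: lie_bracket_gl_unit_left lie_bracket_matrix_unit)
    have act_h: "act ?h f = M_act p ?h f" for f
      using agree_gl by (simp add: agree_def)
    have "act ?h (act ?y 1) = act ?y (act ?h 1) - act ?y 1"
      using act_swap[of ?h ?y 1] by (simp add: bracket act_minus)
    moreover have "M_act p ?h (M_act p ?y 1) = M_act p ?y (M_act p ?h 1) - M_act p ?y 1"
      using M.act_swap[of ?h ?y 1] by (simp add: bracket M.act_minus)
    ultimately have "M_act p ?h w = ?W (M_act p ?h 1) - w"
      unfolding w_def by (simp add: act_h M.act_diff_right)
    \<comment> \<open>The terms \<open>pcoef p i i * w\<close> cancel. Any \<open>w\<close> would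
      then have weight -1 under x_i d/dx_i, whose eigenvalues on monomials are nonnegative
      integers.\<close>
    then have "mvar i * mderiv i w = - w"
      unfolding W by (simp add: M_act_gl_unit algebra_simps eq_neg_iff_add_eq_0)
    then have "of_nat (Poly_Mapping.lookup m i + 1) * Poly_Mapping.lookup w m = 0" for m
      by (simp add: distrib_right flip: lookup_mvar_mderiv)
    then have "w = 0"
      by (intro poly_mapping_eqI) (simp only: mult_eq_0_iff of_nat_eq_0_iff, simp)
    with W show ?thesis by (simp add: agree_def)
  qed

  have "agree A" if "A \<in> sl" for A
    using that
  proof (induction A rule: sl_induct)
    case (scale c A)
    then show ?case by (simp add: agree_def sl_scale act_scale M.act_scale)
  qed (auto intro: agree_add agree_gl agree_raise agree_lower)
  then show ?thesis using that by (simp add: agree_def)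
qed


section \<open>Isomorphisms\<close>

lemma sl_module_iso_sym:
  assumes "sl_module_iso sc act sc' act'"
  shows "sl_module_iso sc' act' sc act"
proof -
  obtain \<phi> where lin: "Vector_Spaces.linear sc sc' \<phi>" and "bij \<phi>"
    and comm: "\<And>A v. A \<in> sl \<Longrightarrow> \<phi> (act A v) = act' A (\<phi> v)"
    using assms by (auto simp: sl_module_iso_def)
  have inv: "inv \<phi> (\<phi> v) = v" "\<phi> (inv \<phi> w) = w" for v w
    using \<open>bij \<phi>\<close> by (simp_all add: bij_is_inj bij_is_surj surj_f_inv_f)
  have inj: "v = w" if "\<phi> v = \<phi> w" for v w
    using that \<open>bij \<phi>\<close> by (metis inv(1))
  show ?thesis
    unfolding sl_module_iso_def
  proof (intro exI conjI ballI allI)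
    show "Vector_Spaces.linear sc' sc (inv \<phi>)"
      using lin unfolding Vector_Spaces.linear_iff by (auto intro!: inj simp: inv)
    show "bij (inv \<phi>)"
      using \<open>bij \<phi>\<close> by (rule bij_imp_bij_inv)
    show "inv \<phi> (act' A v) = act A (inv \<phi> v)" if "A \<in> sl" for A v
      by (rule inj) (simp add: inv comm that)
  qed
qed

lemma sl_module_iso_trans:
  assumes "sl_module_iso sc act sc' act'" "sl_module_iso sc' act' sc'' act''"
  shows "sl_module_iso sc act sc'' act''"
proof -
  obtain \<phi> \<psi> where \<phi>: "Vector_Spaces.linear sc sc' \<phi>" "bij \<phi>" "\<And>A v. A \<in> sl \<Longrightarrow> \<phi> (act A v) = act' A (\<phi> v)"
    and \<psi>: "Vector_Spaces.linear sc' sc'' \<psi>" "bij \<psi>" "\<And>A v. A \<in> sl \<Longrightarrow> \<psi> (act' A v) = act'' A (\<psi> v)"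
    using assms by (auto simp: sl_module_iso_def)
  show ?thesis
    unfolding sl_module_iso_def
    by (rule exI[of _ "\<psi> \<circ> \<phi>"])
      (auto simp: \<phi> \<psi> intro: Vector_Spaces.linear_compose \<phi> \<psi> bij_comp)
qed

lemma M_act_iso_imp_eq:
  fixes p p' :: "('n::finite, 'a::field_char_0) mpoly"
  assumes "sl_module_iso mscale (M_act p) mscale (M_act p')"
  shows "p = p'"
proof -
  obtain \<phi> where lin: "Vector_Spaces.linear mscale mscale \<phi>" and "bij \<phi>"
    and comm: "\<And>A f. A \<in> sl \<Longrightarrow> \<phi> (M_act p A f) = M_act p' A (\<phi> f)"
    using assms by (auto simp: sl_module_iso_def)
  have mult: "\<phi> f = f * \<phi> 1" for f
  proof (rule module_endo_eq_mult)
    show "\<phi> (f + g) = \<phi> f + \<phi> g" "\<phi> (mconst c * f) = mconst c * \<phi> f" for f g c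
      using lin by (simp_all add: Vector_Spaces.linear_iff mscale_def)
    show "\<phi> (mvar i * f) = mvar i * \<phi> f" for i f
      using comm[of "matrix_unit (Some i) None" f] by (simp add: M_act_matrix_unit matrix_unit_in_sl)
  qed
  \<comment> \<open>A preimage of 1 is an inverse of \<open>\<phi> 1\<close>, so
    \<open>\<phi>\<close> is multiplication by a nonzero constant.\<close>
  obtain v where "v * \<phi> 1 = 1"
    using \<open>bij \<phi>\<close> mult by (metis bij_is_surj surj_def)
  then have v: "\<phi> 1 * v = 1" by (simp add: mult.commute)
  obtain c where c: "\<phi> 1 = mconst c"
    using unit_imp_mconst[OF v] by blast
  have pcoef: "pcoef p i j = pcoef p' i j" for i j
  proof -
    have "pcoef p i j * \<phi> 1 = \<phi> (M_act p (gl_unit i j) 1)"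
      by (subst mult) (simp add: M_act_gl_unit)
    also have "\<dots> = M_act p' (gl_unit i j) (\<phi> 1)"
      by (intro comm gl_unit_in_sl)
    also have "\<dots> = pcoef p' i j * \<phi> 1"
      by (simp add: M_act_gl_unit c)
    finally have "pcoef p i j * (\<phi> 1 * v) = pcoef p' i j * (\<phi> 1 * v)"
      by (simp flip: mult.assoc)
    then show ?thesis by (simp add: v)
  qed
  \<comment> \<open>Any diagonal index will do: the constant term of p_ii is
    \<open>pconst p\<close>.\<close>
  have "pconst p = pconst p'"
    using arg_cong[OF pcoef[of undefined undefined], of "\<lambda>f. Poly_Mapping.lookup f 0"]
    by (simp add: pcoef_eq lookup_add lookup_mconst)
  moreover from this have "mderiv i p = mderiv i p'" for i
    using pcoef[of i i] by (simp add: pcoef_eq mvar_mult_cancel)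
  ultimately show ?thesis
    using mderiv_eq_imp_eq[of p p'] by (simp add: pconst_def)
qed

text \<open>A basis vector \<open>b\<close> identifies the polynomial ring with the module by
  sending \<open>f\<close> to \<open>f\<close> acting on \<open>b\<close>. The action is transported
  along this bijection, under which e_{i,n+1} becomes multiplication by x_i.\<close>

lemma exists_M_act_iso:
  fixes act :: "'a::field_char_0 ^ 'n option ^ 'n::finite option \<Rightarrow> 'm::ab_group_add \<Rightarrow> 'm"
  assumes "sl_module sc act" and "Un_free_of_rank sc act 1"
  obtains p where "sl_module_iso sc act mscale (M_act p)"
proof -
  interpret sl_module sc act by fact
  obtain uscale :: "('n, 'a) mpoly \<Rightarrow> 'm \<Rightarrow> 'm" and B where "module uscale"
    and const: "\<And>c v. uscale (mconst c) v = sc c v"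
    and var: "\<And>i v. uscale (mvar i) v = act (matrix_unit (Some i) None) v"
    and B: "card B = 1" "\<not> module.dependent uscale B" "module.span uscale B = UNIV"
    using assms(2) by (auto simp: Un_free_of_rank_def is_restriction_Un_def free_of_rank_def)
  interpret U: module uscale by fact
  obtain b where b: "B = {b}" using B(1) by (auto simp: card_1_singleton_iff)
  define \<phi> where "\<phi> f = uscale f b" for f
  have "bij \<phi>"
  proof (rule bijI)
    have "f = 0" if "uscale f b = 0" for f
      using B(2) that unfolding b U.dependent_explicit by force
    then show "inj \<phi>"
      unfolding inj_def \<phi>_def by (metis U.scale_left_diff_distrib eq_iff_diff_eq_0)
    show "surj \<phi>"
      using B(3) unfolding b U.span_singleton by (auto simp: \<phi>_def)
  qed
  have \<phi>_add: "\<phi> (f + g) = \<phi> f + \<phi> g" for f g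
    by (simp add: \<phi>_def U.scale_left_distrib)
  have \<phi>_scale: "\<phi> (mscale c f) = sc c (\<phi> f)" for c f
    by (simp add: \<phi>_def mscale_def const flip: U.scale_scale)
  define \<psi> where "\<psi> = inv \<phi>"
  have inv: "\<psi> (\<phi> f) = f" "\<phi> (\<psi> v) = v" for f v
    using \<open>bij \<phi>\<close> by (simp_all add: \<psi>_def bij_is_inj bij_is_surj surj_f_inv_f)
  have \<psi>_add: "\<psi> (v + w) = \<psi> v + \<psi> w" for v w
    by (metis inv \<phi>_add)
  have \<psi>_diff: "\<psi> (v - w) = \<psi> v - \<psi> w" for v w
    by (metis \<psi>_add add_diff_cancel diff_add_cancel)
  have \<psi>_scale: "\<psi> (sc c v) = mscale c (\<psi> v)" for c v
    by (metis inv \<phi>_scale)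
  define act' where "act' A f = \<psi> (act A (\<phi> f))" for A f
  have "sl_module mscale act'"
  proof (intro sl_module.intro sl_module_axioms.intro)
    show "vector_space (mscale :: 'a \<Rightarrow> ('n, 'a) mpoly \<Rightarrow> ('n, 'a) mpoly)"
      by (rule vector_space_mscale)
    fix A :: "'a ^ 'n option ^ 'n option"
    assume A: "A \<in> sl"
    show "Vector_Spaces.linear mscale mscale (act' A)"
      using act_linear[OF A]
      by (simp add: Vector_Spaces.linear_iff vector_space_mscale act'_def \<phi>_add \<phi>_scale \<psi>_add \<psi>_scale)
    show "act' (\<chi> i j. c * A $ i $ j) f = mscale c (act' A f)" for c f
      by (simp add: act'_def act_scale A \<psi>_scale)
    fix B :: "'a ^ 'n option ^ 'n option"
    assume B: "B \<in> sl"
    show "act' (A + B) f = act' A f + act' B f" for f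
      by (simp add: act'_def act_add A B \<psi>_add)
    show "act' (lie_bracket A B) f = act' A (act' B f) - act' B (act' A f)" for f
      by (simp add: act'_def act_bracket A B \<psi>_diff inv)
  qed
  moreover have "act' (matrix_unit (Some i) None) f = mvar i * f" for i f
  proof -
    have "act (matrix_unit (Some i) None) (\<phi> f) = \<phi> (mvar i * f)"
      by (simp add: \<phi>_def var[symmetric])
    then show ?thesis by (simp only: inv(1) act'_def)
  qed
  ultimately obtain p where p: "\<And>A f. A \<in> sl \<Longrightarrow> act' A f = M_act p A f"
    by (rule sl_module_mult_eq_M_act) blast
  have "sl_module_iso sc act mscale (M_act p)"
    unfolding sl_module_iso_def
  proof (intro exI conjI ballI allI)
    show "Vector_Spaces.linear sc mscale \<psi>"
      by (simp add: Vector_Spaces.linear_iff vector_space_mscale vector_space_axioms \<psi>_add \<psi>_scale)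
    show "bij \<psi>"
      unfolding \<psi>_def using \<open>bij \<phi>\<close> by (rule bij_imp_bij_inv)
    show "\<psi> (act A v) = M_act p A (\<psi> v)" if "A \<in> sl" for A v
      using p[OF that, of "\<psi> v"] by (simp add: act'_def inv)
  qed
  then show ?thesis by (rule that)
qed

theorem theorem1:
  shows "(\<forall>p :: ('n::finite, 'a::{alg_closed_field, field_char_0}) mpoly.
      sl_module mscale (M_act p) \<and>
      (\<forall>i f. M_act p (matrix_unit (Some i) None) f = mvar i * f) \<and>
      (\<forall>i f. M_act p (cartan i) f = pcoef p i i * f + mvar i * mderiv i f) \<and>
      (\<forall>i j f. i \<noteq> j \<longrightarrow>
         M_act p (matrix_unit (Some i) (Some j)) f = pcoef p i j * f + mvar i * mderiv j f) \<and>
      (\<forall>i f. M_act p (matrix_unit None (Some i)) f =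
         qcoef p i * f - (\<Sum>r\<in>UNIV. pcoef p r i * mderiv r f + pcoef p r r * mderiv i f
           + mvar r * mderiv i (mderiv r f))))
    \<and> (\<forall>(sc :: 'a \<Rightarrow> 'm::ab_group_add \<Rightarrow> 'm)
         (act :: 'a ^ 'n option ^ 'n option \<Rightarrow> 'm \<Rightarrow> 'm).
      sl_module sc act \<and> Un_free_of_rank sc act 1 \<longrightarrow>
      (\<exists>!p :: ('n, 'a) mpoly. sl_module_iso sc act mscale (M_act p)))"
proof (intro conjI allI impI)
  fix sc :: "'a \<Rightarrow> 'm \<Rightarrow> 'm" and act :: "'a ^ 'n option ^ 'n option \<Rightarrow> 'm \<Rightarrow> 'm"
  assume "sl_module sc act \<and> Un_free_of_rank sc act 1"
  then obtain p :: "('n, 'a) mpoly" where "sl_module_iso sc act mscale (M_act p)"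
    by (meson exists_M_act_iso)
  \<comment> \<open>Two isomorphisms out of the same module compose to one between M(p') and
    M(p).\<close>
  moreover have "p' = p" if "sl_module_iso sc act mscale (M_act p')" for p' :: "('n, 'a) mpoly"
    using sl_module_iso_trans[OF sl_module_iso_sym[OF that] calculation] by (rule M_act_iso_imp_eq)
  ultimately show "\<exists>!p :: ('n, 'a) mpoly. sl_module_iso sc act mscale (M_act p)"
    by blast
next
  fix p f :: "('n, 'a) mpoly" and i j :: 'n
  show "sl_module mscale (M_act p)"
    by (rule sl_module_M_act)
  show "M_act p (matrix_unit (Some i) None) f = mvar i * f"
    by (simp add: M_act_matrix_unit)
  show "M_act p (cartan i) f = pcoef p i i * f + mvar i * mderiv i f"
    by (simp only: cartan_eq_gl_unit M_act_gl_unit)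
  show "M_act p (matrix_unit (Some i) (Some j)) f = pcoef p i j * f + mvar i * mderiv j f" if "i \<noteq> j"
    using that M_act_gl_unit[of p i j f] by (simp add: gl_unit_def)
  show "M_act p (matrix_unit None (Some i)) f =
      qcoef p i * f - (\<Sum>r\<in>UNIV. pcoef p r i * mderiv r f + pcoef p r r * mderiv i f
        + mvar r * mderiv i (mderiv r f))"
    by (simp only: qcoef_act M_act_matrix_unit[OF option.distinct(1)] unit_act.simps)
qed

end
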